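(* Consider the generalized posterior $\pi(\theta\mid y)\propto\pi(y,\theta)$ of the pseudo-likelihood generalized linear mixed model described in the context, approximated within the variational family $\mathcal Q$ described there, and let $\mu^{(t)},\Sigma^{(t)},\alpha_h^{(t)},\beta_h^{(t)}$ ($h=1,\dots,H$) be the current variational parameters after iteration $t$. Put $\xi_i^{(t)}=c_i^\top\mu^{(t)}$, $(\nu_i^{(t)})^2=c_i^\top\Sigma^{(t)}c_i$, and for $r=0,1,2$ let $\boldsymbol\Psi_r^{(t)}\in\mathbb R^n$ be the vector with entries $\Psi_r(y_i,\xi_i^{(t)},(\nu_i^{(t)})^2)$. Define $$p^{(t)}=-\boldsymbol\Psi_1^{(t)}/\boldsymbol\Psi_2^{(t)}+\xi^{(t)}\ \text{(element-wise division)},\qquad W^{(t)}=\mathrm{diag}\big[\boldsymbol\Psi_2^{(t)}\big],$$ $$\bar R^{(t)}=\mathrm{blockdiag}\big[\sigma_\beta^{-2}R_\beta,\ (\alpha_1^{(t)}/\beta_1^{(t)})R_1,\dots,(\alpha_H^{(t)}/\beta_H^{(t)})R_H\big].$$ Then the optimal message passing update for $q^{(t+1)}(\beta,u)$ (defined in the context) is given, in the natural parametrization, by $$\lambda_1^{(t+1)}= C^\top W^{(t)}p^{(t)},\qquad \lambda_2^{(t+1)}=-\tfrac12\big[\bar R^{(t)}+C^\top W^{(t)}C\big],$$ and equivalently, in the mean-variance parametrization, by $$\Sigma^{(t+1)}=\big[\bar R^{(t)}+C^\top W^{(t)}C\big]^{-1},\qquad \mu^{(t+1)}=\Sigma^{(t+1)}C^\top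 W^{(t)}p^{(t)}.$$ Moreover, for each $h=1,\dots,H$, the optimal message passing update for $q^{(t+1)}(\sigma_h^2)$ (defined in the context) is the Inverse-Gamma density $\mathrm{IG}(\alpha_h^{(t+1)},\beta_h^{(t+1)})$ with $$\alpha_h^{(t+1)}=A_h+\frac{d_h}{2},\qquad \beta_h^{(t+1)}=B_h+\frac12\Big\{\mu_h^{(t)\top}R_h\,\mu_h^{(t)}+\mathrm{tr}\big[R_h\Sigma_{hh}^{(t)}\big]\Big\}.$$
   Context: Model: $y_i\mid\eta_i\sim\pi(y_i\mid\eta_i)\propto\exp\{-\psi(y_i,\eta_i)\}$ for $i=1,\dots,n$ (so $\log\pi(y\mid\theta)=-\sum_i\psi(y_i,\eta_i)$ up to an additive constant), where $\psi(\cdot,\cdot)$ is a continuous loss and $\eta_i=x_i^\top\beta+\sum_{h=1}^H z_{ih}^\top u_h$, with $\beta\in\mathbb R^p$, $u_h\in\mathbb R^{d_h}$. Priors (with $\beta$, the pairs $(u_h,\sigma_h^2)$ mutually independent): $\beta\sim N_p(0,\sigma_\beta^2R_\beta^{-1})$, $u_h\mid\sigma_h^2\sim N_{d_h}(0,\sigma_h^2R_h^{-1})$, $\sigma_h^2\sim\mathrm{IG}(A_h,B_h)$, with $R_\beta,R_h$ fixed symmetric positive semi-definite matrices (if singular, the Gaussian prior of $u_h$ is understood as the density proportional to $(\sigma_h^2)^{-d_h/2}\exp\{-u_h^\top R_hu_h/(2\sigma_h^2)\}$, and similarly for $\beta$) and $\sigma_\beta^2,A_h,B_h>0$ fixed.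 $\mathrm{IG}(a,b)$ has density proportional to $x^{-a-1}e^{-b/x}$ on $x>0$. Write $u=(u_1,\dots,u_H)$, $\theta=(\beta,u,\sigma_1^2,\dots,\sigma_H^2)$, $c_i^\top=(x_i^\top,z_{i1}^\top,\dots,z_{iH}^\top)$, and let $C$ be the matrix with rows $c_i^\top$. Variational family: $\mathcal Q$ is the set of densities $q(\theta)=q(\beta,u)\prod_{h=1}^Hq(\sigma_h^2)$ where $q(\beta,u)$ is the $N(\mu,\Sigma)$ density and $q(\sigma_h^2)$ is the $\mathrm{IG}(\alpha_h,\beta_h)$ density. $\mu_h$ and $\Sigma_{hh}$ denote the mean and covariance of $u_h$ under $q$ (sub-vector/diagonal sub-block of $\mu$, $\Sigma$). $\mathbb E_q^{(t)}$ is expectation under the current $q^{(t)}$. Variational loss: $\Psi_r(y,\xi,\nu^2)=\dfrac{\partial^r}{\partial\xi^r}\displaystyle\int_{-\infty}^{\infty}\psi(y,\xi+\nu z)\,\phi(z)\,dz$, with $\phi$ the standard Gaussian density; $\psi(y,\cdot)$ is assumed integrable with respect to every Gaussian law, so that these are well defined. The entries of $\boldsymbol\Psi_2^{(t)}$ are assumed nonzero and $\bar R^{(t)}+C^\top W^{(t)}C$ invertible, so that the displayed expressions make sense. Optimal message passing update for the Gaussian block (non-conjugate variational message passing): with $g^{(t)}=\nabla_\mu\mathbb E_q\{\log\pi(y,\theta)\}$ and $H^{(t)}=\nabla^2_\mu\mathbb E_q\{\log\pi(y,\theta)\}$ evaluated at the current variational parameters, the update of the natural parameters $\lambda_1=\Sigma^{-1}\mu$,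 $\lambda_2=-\Sigma^{-1}/2$ is by definition $\lambda_1^{(t+1)}=g^{(t)}-H^{(t)}\mu^{(t)}$, $\lambda_2^{(t+1)}=H^{(t)}/2$; equivalently $\mu^{(t+1)}=\mu^{(t)}-[H^{(t)}]^{-1}g^{(t)}$, $\Sigma^{(t+1)}=-[H^{(t)}]^{-1}$. Optimal message passing update for $\sigma_h^2$ (mean field update): $q^{(t+1)}(\sigma_h^2)\propto\exp\big[\mathbb E^{(t)}_{-\sigma_h^2}\{\log\pi(\sigma_h^2\mid\text{rest})\}\big]$, where $\pi(\sigma_h^2\mid\text{rest})$ is the full conditional density of $\sigma_h^2$ given $y$ and all other parameters, and the expectation is over all parameters other than $\sigma_h^2$ under $q^{(t)}$. *)

theory Defs
  imports "HOL-Probability.Probability"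
begin

text \<open>
  The coordinates of \<open>\<beta>\<close> are indexed by \<open>'p\<close>.  The coordinates of the stacked vector
  \<open>u = (u\<^sub>1, \<dots>, u\<^sub>H)\<close> are indexed by \<open>'d\<close>, and a map \<open>blk :: 'd \<Rightarrow> 'h\<close> says to which \<open>u\<^sub>h\<close> a
  coordinate belongs, so that the block sizes \<open>d\<^sub>h\<close> are arbitrary and may differ.
  A vector or matrix attached to block \<open>h\<close> is stored as a vector or matrix over \<open>'d\<close> that
  vanishes outside block \<open>h\<close>; quadratic forms, traces and positive semi-definiteness are
  unaffected by this padding.
\<close>

definition block_dim :: "('d::finite \<Rightarrow> 'h) \<Rightarrow> 'h \<Rightarrow> nat" where
  "block_dim blk h = card {j. blk j = h}"

definition block_vec :: "('d::finite \<Rightarrow> 'h) \<Rightarrow> 'h \<Rightarrow> real^'d \<Rightarrow> real^'d" where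
  "block_vec blk h v = (\<chi> j. if blk j = h then v $ j else 0)"

definition block_mat :: "('d::finite \<Rightarrow> 'h) \<Rightarrow> 'h \<Rightarrow> real^'d^'d \<Rightarrow> real^'d^'d" where
  "block_mat blk h M = (\<chi> i j. if blk i = h \<and> blk j = h then M $ i $ j else 0)"

definition beta_part :: "real^('p::finite + 'd::finite) \<Rightarrow> real^'p" where
  "beta_part b = (\<chi> j. b $ Inl j)"

definition u_part :: "real^('p::finite + 'd::finite) \<Rightarrow> real^'d" where
  "u_part b = (\<chi> j. b $ Inr j)"

definition uu_part ::
  "real^('p::finite + 'd::finite)^('p + 'd) \<Rightarrow> real^'d^'d" where
  "uu_part S = (\<chi> i j. S $ Inr i $ Inr j)"

definition sym_psd :: "real^'k^'k::finite \<Rightarrow> bool" where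
  "sym_psd M \<longleftrightarrow> transpose M = M \<and> (\<forall>v. v \<bullet> (M *v v) \<ge> 0)"

definition sym_pd :: "real^'k^'k::finite \<Rightarrow> bool" where
  "sym_pd M \<longleftrightarrow> transpose M = M \<and> (\<forall>v. v \<noteq> 0 \<longrightarrow> v \<bullet> (M *v v) > 0)"

definition diag_mat :: "real^'n::finite \<Rightarrow> real^'n^'n" where
  "diag_mat w = (\<chi> i j. if i = j then w $ i else 0)"

definition mvn_density :: "real^'k::finite \<Rightarrow> real^'k^'k \<Rightarrow> real^'k \<Rightarrow> real" where
  "mvn_density mu S x =
     exp (- ((x - mu) \<bullet> (matrix_inv S *v (x - mu))) / 2)
       / sqrt ((2 * pi) ^ CARD('k) * det S)"

definition ig_density :: "real \<Rightarrow> real \<Rightarrow> real \<Rightarrow> real" where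
  "ig_density a b x =
     (if x > 0 then b powr a / Gamma a * x powr (- a - 1) * exp (- b / x) else 0)"

definition design_mat ::
  "real^'p::finite^'n::finite \<Rightarrow> real^'d::finite^'n \<Rightarrow> real^('p + 'd)^'n" where
  "design_mat X Z = (\<chi> i j. case j of Inl a \<Rightarrow> X $ i $ a | Inr a \<Rightarrow> Z $ i $ a)"

definition lin_pred ::
  "('d::finite \<Rightarrow> 'h::finite) \<Rightarrow> real^'p::finite^'n::finite \<Rightarrow> real^'d^'n
     \<Rightarrow> real^('p + 'd) \<Rightarrow> 'n \<Rightarrow> real" where
  "lin_pred blk X Z b i =
     X $ i \<bullet> beta_part b
       + (\<Sum>h\<in>UNIV. block_vec blk h (Z $ i) \<bullet> block_vec blk h (u_part b))"

text \<open>
  A parameter \<open>\<theta>\<close> is a pair of \<open>(\<beta>, u)\<close> and the family \<open>(\<sigma>\<^sub>h\<^sup>2)\<^sub>h\<close>.  The following is \<open>\<pi>(y, \<theta>)\<close>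
  without the factors free of \<open>\<theta>\<close>; in particular the Gaussian normalising constants that
  depend only on \<open>R\<^sub>\<beta>\<close>, \<open>R\<^sub>h\<close> and \<open>\<sigma>\<^sub>\<beta>\<^sup>2\<close> are dropped, which makes sense for singular matrices too.
\<close>

definition joint_kernel ::
  "('y \<Rightarrow> real \<Rightarrow> real) \<Rightarrow> ('n::finite \<Rightarrow> 'y) \<Rightarrow> ('d::finite \<Rightarrow> 'h::finite)
     \<Rightarrow> real^'p::finite^'n \<Rightarrow> real^'d^'n
     \<Rightarrow> real \<Rightarrow> real^'p^'p \<Rightarrow> ('h \<Rightarrow> real^'d^'d) \<Rightarrow> ('h \<Rightarrow> real) \<Rightarrow> ('h \<Rightarrow> real)
     \<Rightarrow> (real^('p + 'd)) \<times> ('h \<Rightarrow> real) \<Rightarrow> real" where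
  "joint_kernel psi y blk X Z sb2 Rb R A B = (\<lambda>(b, s).
     (\<Prod>i\<in>UNIV. exp (- psi (y i) (lin_pred blk X Z b i)))
     * exp (- (beta_part b \<bullet> (Rb *v beta_part b)) / (2 * sb2))
     * (\<Prod>h\<in>UNIV.
          s h powr (- real (block_dim blk h) / 2)
          * exp (- (block_vec blk h (u_part b) \<bullet> (R h *v block_vec blk h (u_part b)))
                 / (2 * s h))
          * ig_density (A h) (B h) (s h)))"

text \<open>
  \<open>J\<close> is the set of those \<open>h\<close> for which \<open>\<sigma>\<^sub>h\<^sup>2\<close> is kept: \<open>J = UNIV\<close> gives the expectation under
  \<open>q(\<theta>)\<close>, and \<open>J = UNIV - {h}\<close> the one over all parameters other than \<open>\<sigma>\<^sub>h\<^sup>2\<close>.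
\<close>

definition q_density ::
  "'h set \<Rightarrow> real^'k::finite \<Rightarrow> real^'k^'k \<Rightarrow> ('h \<Rightarrow> real) \<Rightarrow> ('h \<Rightarrow> real)
     \<Rightarrow> (real^'k) \<times> ('h \<Rightarrow> real) \<Rightarrow> real" where
  "q_density J mu S al be =
     (\<lambda>(b, s). mvn_density mu S b * (\<Prod>h\<in>J. ig_density (al h) (be h) (s h)))"

definition q_expectation ::
  "'h set \<Rightarrow> real^'k::finite \<Rightarrow> real^'k^'k \<Rightarrow> ('h \<Rightarrow> real) \<Rightarrow> ('h \<Rightarrow> real)
     \<Rightarrow> ((real^'k) \<times> ('h \<Rightarrow> real) \<Rightarrow> real) \<Rightarrow> real" where
  "q_expectation J mu S al be f =
     (LINT \<theta>|(lborel \<Otimes>\<^sub>M Pi\<^sub>M J (\<lambda>_. lborel)). q_density J mu S al be \<theta> * f \<theta>)"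

definition variational_loss ::
  "('y \<Rightarrow> real \<Rightarrow> real) \<Rightarrow> nat \<Rightarrow> 'y \<Rightarrow> real \<Rightarrow> real \<Rightarrow> real" where
  "variational_loss psi r y xi nu2 =
     (deriv ^^ r) (\<lambda>xi. LINT z|lborel. psi y (xi + sqrt nu2 * z) * std_normal_density z) xi"

definition has_grad_hess ::
  "(real^'k::finite \<Rightarrow> real) \<Rightarrow> real^'k \<Rightarrow> real^'k \<Rightarrow> real^'k^'k \<Rightarrow> bool" where
  "has_grad_hess F x g H \<longleftrightarrow>
     (\<exists>G. (\<forall>\<^sub>F m in nhds x. GDERIV F m :> G m) \<and> G x = g
        \<and> (G has_derivative (\<lambda>v. H *v v)) (at x))"

definition expected_log_joint ::
  "((real^'k::finite) \<times> ('h \<Rightarrow> real) \<Rightarrow> real) \<Rightarrow> real^'k^'k \<Rightarrow> ('h \<Rightarrow> real) \<Rightarrow> ('h \<Rightarrow> real)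
     \<Rightarrow> real^'k \<Rightarrow> real" where
  "expected_log_joint joint S al be mu =
     q_expectation UNIV mu S al be (\<lambda>\<theta>. ln (joint \<theta>))"

text \<open>
  The message passing updates are relations between the current parameters and the updated
  ones, so that an update exists only if the derivatives it involves do.
\<close>

definition ncvmp_natural ::
  "((real^'k::finite) \<times> ('h \<Rightarrow> real) \<Rightarrow> real)
     \<Rightarrow> real^'k \<Rightarrow> real^'k^'k \<Rightarrow> ('h \<Rightarrow> real) \<Rightarrow> ('h \<Rightarrow> real)
     \<Rightarrow> real^'k \<Rightarrow> real^'k^'k \<Rightarrow> bool" where
  "ncvmp_natural joint mu S al be l1 l2 \<longleftrightarrow>
     (\<exists>g H. has_grad_hess (expected_log_joint joint S al be) mu g H
        \<and> l1 = g - H *v mu \<and> l2 = (1/2) *\<^sub>R H)"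

definition ncvmp_mean_var ::
  "((real^'k::finite) \<times> ('h \<Rightarrow> real) \<Rightarrow> real)
     \<Rightarrow> real^'k \<Rightarrow> real^'k^'k \<Rightarrow> ('h \<Rightarrow> real) \<Rightarrow> ('h \<Rightarrow> real)
     \<Rightarrow> real^'k \<Rightarrow> real^'k^'k \<Rightarrow> bool" where
  "ncvmp_mean_var joint mu S al be mu' S' \<longleftrightarrow>
     (\<exists>g H. has_grad_hess (expected_log_joint joint S al be) mu g H \<and> invertible H
        \<and> mu' = mu - matrix_inv H *v g \<and> S' = - matrix_inv H)"

definition natural_params ::
  "real^'k::finite \<Rightarrow> real^'k^'k \<Rightarrow> (real^'k) \<times> (real^'k^'k)" where
  "natural_params mu S = (matrix_inv S *v mu, - ((1/2) *\<^sub>R matrix_inv S))"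

definition full_conditional ::
  "((real^'k::finite) \<times> ('h \<Rightarrow> real) \<Rightarrow> real) \<Rightarrow> 'h
     \<Rightarrow> (real^'k) \<times> ('h \<Rightarrow> real) \<Rightarrow> real \<Rightarrow> real" where
  "full_conditional joint h = (\<lambda>(b, s) x.
     joint (b, s(h := x)) / (LINT t|lborel. joint (b, s(h := t))))"

text \<open>
  The full conditional vanishes on the non-positive reals, where its logarithm is \<open>-\<infinity>\<close> (but
  \<^term>\<open>ln (0::real) = 0\<close>); hence the separate clause for \<open>x \<le> 0\<close>.
\<close>

definition mean_field_update ::
  "((real^'k::finite) \<times> ('h \<Rightarrow> real) \<Rightarrow> real)
     \<Rightarrow> real^'k \<Rightarrow> real^'k^'k \<Rightarrow> ('h \<Rightarrow> real) \<Rightarrow> ('h \<Rightarrow> real)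
     \<Rightarrow> 'h \<Rightarrow> (real \<Rightarrow> real) \<Rightarrow> bool" where
  "mean_field_update joint mu S al be h q \<longleftrightarrow>
     (\<forall>x\<le>0. q x = 0)
     \<and> (\<exists>K>0. \<forall>x>0. q x = K * exp (q_expectation (UNIV - {h}) mu S al be
                                   (\<lambda>\<theta>. ln (full_conditional joint h \<theta> x))))
     \<and> has_bochner_integral lborel q 1"

definition prior_precision ::
  "('d::finite \<Rightarrow> 'h::finite) \<Rightarrow> real \<Rightarrow> real^'p::finite^'p \<Rightarrow> ('h \<Rightarrow> real^'d^'d)
     \<Rightarrow> ('h \<Rightarrow> real) \<Rightarrow> ('h \<Rightarrow> real) \<Rightarrow> real^('p + 'd)^('p + 'd)" where
  "prior_precision blk sb2 Rb R al be = (\<chi> i j. case (i, j) of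
       (Inl a, Inl b) \<Rightarrow> Rb $ a $ b / sb2
     | (Inr a, Inr b) \<Rightarrow>
         (if blk a = blk b then al (blk a) / be (blk a) * R (blk a) $ a $ b else 0)
     | _ \<Rightarrow> 0)"

end

theory Submission
  imports Defs
begin

text \<open>
  Under \<open>N(\<mu>, \<Sigma>)\<close> the linear predictor \<open>c\<^sub>i \<bullet> b\<close> is \<open>N(\<xi>\<^sub>i, \<nu>\<^sub>i\<^sup>2)\<close>, so up to a constant the expected log joint
  density, as a function of \<open>\<mu>\<close> for fixed \<open>\<Sigma>\<close>, is \<open>- (\<Sum>i. \<Psi>\<^sub>0(y\<^sub>i, c\<^sub>i \<bullet> \<mu>, \<nu>\<^sub>i\<^sup>2)) - (\<mu> \<bullet> (R *v \<mu>)) / 2\<close>,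
  where \<open>R\<close> is the prior precision with \<open>1 / \<sigma>\<^sub>h\<^sup>2\<close> replaced by its mean \<open>\<alpha>\<^sub>h / \<beta>\<^sub>h\<close>.  Smoothing the loss
  with a Gaussian makes it differentiable, and the gradient \<open>- C\<^sup>T \<Psi>\<^sub>1 - R \<mu>\<close> and Hessian
  \<open>- (R + C\<^sup>T W C)\<close> give both forms of the update.  By conjugacy the full conditional of
  \<open>\<sigma>\<^sub>h\<^sup>2\<close> is an inverse Gamma density whose logarithm depends on \<open>\<sigma>\<^sub>h\<^sup>2\<close> through
  \<open>- (A\<^sub>h + d\<^sub>h / 2 + 1) ln \<sigma>\<^sub>h\<^sup>2 - (B\<^sub>h + u\<^sub>h \<bullet> (R\<^sub>h *v u\<^sub>h) / 2) / \<sigma>\<^sub>h\<^sup>2\<close>; averaging replaces the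
  quadratic form by its Gaussian expectation.
\<close>

subsection \<open>Linear change of variables for Lebesgue measure\<close>

text \<open>Two obstacles shape the proof. First, a row \<open>C $ i = 0\<close> makes the linear
  predictor deterministic: there \<open>\<nu>\<^sub>i = 0\<close>, nothing is smoothed, and a loss
  that is merely continuous need not be differentiable. Such a row adds a constant to the objective
  and is multiplied by zero in every derivative, so differentiability is claimed only for nonzero
  rows. Second, Bochner integrals of functions that are not integrable are 0, so each term of the
  log density, including \<open>ln\<close> and \<open>1 / x\<close> under the inverse Gamma law,
  needs its integrability before linearity may be used. As the updates are relations, each formula
  is an equivalence: derivatives must exist and be unique, and in the mean field case normalisation
  must fix the proportionality constant.\<close>

lemma borel_measurable_vec_lambda [measurable (raw)]:
  fixes f :: "'a \<Rightarrow> 'n::finite \<Rightarrow> real"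
  assumes "\<And>i. (\<lambda>x. f x i) \<in> borel_measurable M"
  shows "(\<lambda>x. \<chi> i. f x i) \<in> borel_measurable M"
  by (subst borel_measurable_euclidean_space)
     (auto simp: Basis_vec_def inner_axis intro: assms)

lemma borel_measurable_matrix_vector_mult [measurable (raw)]:
  fixes A :: "real^'n^'m"
  assumes [measurable]: "f \<in> borel_measurable M"
  shows "(\<lambda>x. A *v f x) \<in> borel_measurable M"
  by (rule borel_measurable_continuous_on[OF _ assms])
     (auto intro!: linear_continuous_on linear_conv_bounded_linear[THEN iffD1])

lemma Basis_vec_eq_range: "(Basis :: (real^'n) set) = range (\<lambda>i. axis i 1)"
  by (auto simp: Basis_vec_def)

lemma inj_axis: "inj (\<lambda>i::'n::finite. axis i (1::real))"
  by (auto simp: inj_on_def axis_eq_axis)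

lemma prod_Basis_vec:
  fixes f :: "real^'n \<Rightarrow> 'b::comm_monoid_mult"
  shows "(\<Prod>b\<in>Basis. f b) = (\<Prod>i\<in>UNIV. f (axis i 1))"
  unfolding Basis_vec_eq_range by (simp add: prod.reindex[OF inj_axis])

lemma sum_Basis_vec:
  fixes f :: "real^'n \<Rightarrow> 'b::comm_monoid_add"
  shows "(\<Sum>b\<in>Basis. f b) = (\<Sum>i\<in>UNIV. f (axis i 1))"
  unfolding Basis_vec_eq_range by (simp add: sum.reindex[OF inj_axis])

text \<open>Volumes of boxes determine Lebesgue measure, and the preimage of a box is a product of
  intervals. With the product measure, Fubini is available coordinate by coordinate.\<close>

lemma lborel_vec_eq_distr:
  "(lborel :: (real^'n) measure) = distr (Pi\<^sub>M UNIV (\<lambda>_. lborel)) borel (\<lambda>g. \<chi> i. g i)"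
proof (rule lborel_eqI)
  interpret product_sigma_finite "\<lambda>_::'n. lborel :: real measure" ..
  have meas [measurable]: "(\<lambda>g. \<chi> i. g i) \<in> Pi\<^sub>M UNIV (\<lambda>_::'n. lborel :: real measure) \<rightarrow>\<^sub>M borel"
    by measurable
  fix l u :: "real^'n" assume le: "\<And>b. b \<in> Basis \<Longrightarrow> l \<bullet> b \<le> u \<bullet> b"
  have le': "l $ i \<le> u $ i" for i
    using le[of "axis i 1"] by (auto simp: inner_axis axis_in_Basis_iff)
  have "(\<lambda>g. \<chi> i. g i) -` box l u \<inter> space (Pi\<^sub>M UNIV (\<lambda>_::'n. lborel :: real measure))
      = PiE UNIV (\<lambda>i. {l $ i <..< u $ i})"
    by (auto simp: mem_box_cart space_PiM PiE_iff)
  then have "emeasure (distr (Pi\<^sub>M UNIV (\<lambda>_. lborel)) borel (\<lambda>g. \<chi> i. g i)) (box l u)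
     = (\<Prod>i\<in>UNIV. ennreal (u $ i - l $ i))"
    using le' by (simp add: emeasure_distr emeasure_PiM)
  also have "\<dots> = (\<Prod>b\<in>Basis. (u - l) \<bullet> b)"
    using le' by (simp add: prod_Basis_vec inner_axis prod_ennreal)
  finally show "emeasure (distr (Pi\<^sub>M UNIV (\<lambda>_. lborel)) borel (\<lambda>g. \<chi> i. g i)) (box l u)
     = (\<Prod>b\<in>Basis. (u - l) \<bullet> b)" .
qed simp

text \<open>A shear changes one coordinate by a multiple of another. Integrating that coordinate
  innermost reduces the shear to a translation of the line.\<close>

lemma nn_integral_vec_split:
  fixes f :: "real^'n \<Rightarrow> ennreal"
  assumes [measurable]: "f \<in> borel_measurable borel"
  shows "(\<integral>\<^sup>+x. f x \<partial>lborel)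
    = (\<integral>\<^sup>+x. (\<integral>\<^sup>+y. f (\<chi> i. if i = m then y else x i) \<partial>lborel) \<partial>Pi\<^sub>M (UNIV - {m}) (\<lambda>_. lborel))"
proof -
  interpret product_sigma_finite "\<lambda>_::'n. lborel :: real measure" ..
  have "(\<integral>\<^sup>+x. f x \<partial>lborel)
      = (\<integral>\<^sup>+g. f (\<chi> i. g i) \<partial>Pi\<^sub>M (insert m (UNIV - {m})) (\<lambda>_. lborel))"
    by (subst lborel_vec_eq_distr, subst nn_integral_distr) (auto simp: insert_absorb)
  also have "\<dots> = (\<integral>\<^sup>+x. (\<integral>\<^sup>+y. f (\<chi> i. (x(m := y)) i) \<partial>lborel) \<partial>Pi\<^sub>M (UNIV - {m}) (\<lambda>_. lborel))"
    by (rule product_nn_integral_insert) (auto simp: insert_absorb)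
  finally show ?thesis
    by (simp add: fun_upd_def)
qed

text \<open>
  The change of variables theorems of the library require a well-ordered index type, which a sum
  type is not.
\<close>

lemma nn_integral_linear_image:
  fixes A :: "real^'n^'n" and f :: "real^'n \<Rightarrow> ennreal"
  assumes "det A \<noteq> 0" "f \<in> borel_measurable borel"
  shows "(\<integral>\<^sup>+x. f x \<partial>lborel) = ennreal \<bar>det A\<bar> * (\<integral>\<^sup>+x. f (A *v x) \<partial>lborel)"
proof -
  \<comment> \<open>Quantifying over \<open>f\<close> inside \<open>P\<close> is what makes products
    work: the claim for \<open>B\<close> is applied to the composition of \<open>f\<close> with
    \<open>A\<close>. The induction then covers zero rows, diagonal matrices, column swaps and
    shears.\<close>
  define P where "P A \<longleftrightarrow> det A \<noteq> 0 \<longrightarrow> (\<forall>f\<in>borel_measurable borel.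
      (\<integral>\<^sup>+x. f x \<partial>lborel) = ennreal \<bar>det A\<bar> * (\<integral>\<^sup>+x. f (A *v x) \<partial>lborel))" for A :: "real^'n^'n"
  have "P A"
  proof (rule induct_matrix_elementary)
    fix A B :: "real^'n^'n" assume A: "P A" and B: "P B"
    show "P (A ** B)"
      unfolding P_def
    proof (intro impI ballI)
      fix f :: "real^'n \<Rightarrow> ennreal"
      assume det: "det (A ** B) \<noteq> 0" and f [measurable]: "f \<in> borel_measurable borel"
      then have "det A \<noteq> 0" "det B \<noteq> 0"
        by (auto simp: det_mul)
      then have "(\<integral>\<^sup>+x. f x \<partial>lborel) = ennreal \<bar>det A\<bar> * (ennreal \<bar>det B\<bar> * (\<integral>\<^sup>+x. f (A *v (B *v x)) \<partial>lborel))"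
        using A[unfolded P_def, rule_format, of f]
          B[unfolded P_def, rule_format, of "\<lambda>x. f (A *v x)"] by auto
      then show "(\<integral>\<^sup>+x. f x \<partial>lborel) = ennreal \<bar>det (A ** B)\<bar> * (\<integral>\<^sup>+x. f ((A ** B) *v x) \<partial>lborel)"
        by (simp add: det_mul abs_mult ennreal_mult mult.assoc matrix_vector_mul_assoc)
    qed
  next
    fix A :: "real^'n^'n" and i assume "row i A = 0"
    then show "P A"
      by (simp add: P_def det_zero_row)
  next
    fix A :: "real^'n^'n" assume diag: "\<And>i j. i \<noteq> j \<Longrightarrow> A $ i $ j = 0"
    show "P A"
      unfolding P_def
    proof (intro impI ballI)
      fix f :: "real^'n \<Rightarrow> ennreal"
      assume det: "det A \<noteq> 0" and f [measurable]: "f \<in> borel_measurable borel"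
      have det_eq: "det A = (\<Prod>i\<in>UNIV. A $ i $ i)"
        by (rule det_diagonal) (use diag in auto)
      with det have nz: "A $ i $ i \<noteq> 0" for i
        by auto
      \<comment> \<open>\<open>lborel_affine_euclidean\<close> takes scale factors indexed by basis
        vectors; \<open>c\<close> reads the diagonal entry off the basis vector
        \<open>axis i 1\<close>.\<close>
      define c where "c b = (THE r. \<exists>i. b = axis i 1 \<and> r = A $ i $ i)" for b :: "real^'n"
      have c: "c (axis i 1) = A $ i $ i" for i
        unfolding c_def by (rule the_equality) (auto simp: axis_eq_axis)
      have T: "(\<Sum>j\<in>Basis. (c j * (x \<bullet> j)) *\<^sub>R j) = A *v x" for x
      proof -
        have "(\<Sum>j\<in>UNIV. A $ i $ j * x $ j) = (\<Sum>j\<in>UNIV. if j = i then A $ i $ i * x $ i else 0)" for i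
          by (rule sum.cong) (auto simp: diag)
        then show ?thesis
          by (simp add: sum_Basis_vec c inner_axis)
             (simp add: vec_eq_iff matrix_vector_mult_def axis_def if_distrib[of "\<lambda>a. _ * a"] cong: if_cong)
      qed
      have prod: "(\<Prod>j\<in>Basis. \<bar>c j\<bar>) = \<bar>det A\<bar>"
        by (simp add: prod_Basis_vec c det_eq abs_prod)
      have "(lborel :: (real^'n) measure) = density (distr lborel borel (\<lambda>x. 0 + A *v x)) (\<lambda>_. ennreal \<bar>det A\<bar>)"
        unfolding T[symmetric] prod[symmetric]
        by (rule lborel_affine_euclidean) (auto simp: Basis_vec_eq_range c nz)
      then have "(\<integral>\<^sup>+x. f x \<partial>lborel)
          = (\<integral>\<^sup>+x. f x \<partial>density (distr lborel borel (\<lambda>x. 0 + A *v x)) (\<lambda>_. ennreal \<bar>det A\<bar>))"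
        by (rule arg_cong)
      also have "\<dots> = ennreal \<bar>det A\<bar> * (\<integral>\<^sup>+x. f (A *v x) \<partial>lborel)"
        by (subst nn_integral_density) (simp_all add: nn_integral_cmult nn_integral_distr)
      finally show "(\<integral>\<^sup>+x. f x \<partial>lborel) = ennreal \<bar>det A\<bar> * (\<integral>\<^sup>+x. f (A *v x) \<partial>lborel)" .
    qed
  next
    fix m n :: 'n assume "m \<noteq> n"
    let ?p = "Transposition.transpose m n"
    let ?A = "(\<chi> i j. mat 1 $ i $ ?p j) :: real^'n^'n"
    have mult: "?A *v x = (\<chi> i. x $ ?p i)" for x
    proof -
      have "(\<Sum>j\<in>UNIV. if i = ?p j then x $ j else 0) = (\<Sum>j\<in>UNIV. if j = ?p i then x $ j else 0)" for i
        by (rule sum.cong) (auto simp: transpose_involutory)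
      then show ?thesis
        by (simp add: vec_eq_iff matrix_vector_mult_def mat_def if_distrib[of "\<lambda>a. a * _"] cong: if_cong)
    qed
    have det: "\<bar>det ?A\<bar> = 1"
      by (simp add: det_permute_columns permutes_swap_id sign_swap_id abs_mult)
    \<comment> \<open>A swap of coordinates permutes the side lengths of a box, so it preserves
      volumes.\<close>
    have "(lborel :: (real^'n) measure) = distr lborel borel (\<lambda>x. \<chi> i. x $ ?p i)"
    proof (rule lborel_eqI)
      fix l u :: "real^'n" assume le: "\<And>b. b \<in> Basis \<Longrightarrow> l \<bullet> b \<le> u \<bullet> b"
      then have le': "l $ i \<le> u $ i" for i
        using le[of "axis i 1"] by (auto simp: inner_axis axis_in_Basis_iff)
      have box_le: "(\<chi> i. l $ ?p i) \<bullet> b \<le> (\<chi> i. u $ ?p i) \<bullet> b" if "b \<in> Basis" for b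
        using that le' by (auto simp: Basis_vec_eq_range inner_axis)
      have all_p: "(\<forall>i. Q (?p i)) \<longleftrightarrow> (\<forall>i. Q i)" for Q
        by (metis transpose_involutory)
      have "(\<lambda>x::real^'n. \<chi> i. x $ ?p i) -` box l u = box (\<chi> i. l $ ?p i) (\<chi> i. u $ ?p i)"
        using all_p[of "\<lambda>i. l $ i < _ $ ?p i \<and> _ $ ?p i < u $ i"] by (simp add: set_eq_iff mem_box_cart)
      then have "emeasure (distr lborel borel (\<lambda>x. \<chi> i. x $ ?p i)) (box l u)
          = (\<Prod>i\<in>UNIV. u $ ?p i - l $ ?p i)"
        by (simp add: emeasure_distr emeasure_lborel_box box_le prod_Basis_vec inner_axis)
      also have "\<dots> = (\<Prod>i\<in>UNIV. u $ i - l $ i)"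
        using prod.permute[OF permutes_swap_id[of m UNIV n, OF UNIV_I UNIV_I], of "\<lambda>i. u $ i - l $ i", symmetric]
        by (simp only: o_def)
      also have "\<dots> = (\<Prod>b\<in>Basis. (u - l) \<bullet> b)"
        by (simp add: prod_Basis_vec inner_axis)
      finally show "emeasure (distr lborel borel (\<lambda>x. \<chi> i. x $ ?p i)) (box l u) = (\<Prod>b\<in>Basis. (u - l) \<bullet> b)" .
    qed simp
    note lborel_eq = this
    have "(\<integral>\<^sup>+x. f x \<partial>lborel) = (\<integral>\<^sup>+x. f (?A *v x) \<partial>lborel)"
      if [measurable]: "f \<in> borel_measurable borel" for f :: "real^'n \<Rightarrow> ennreal"
    proof -
      have "(\<integral>\<^sup>+x. f x \<partial>lborel) = (\<integral>\<^sup>+x. f x \<partial>distr lborel borel (\<lambda>x. \<chi> i. x $ ?p i))"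
        by (rule arg_cong[OF lborel_eq])
      also have "\<dots> = (\<integral>\<^sup>+x. f (?A *v x) \<partial>lborel)"
        unfolding mult by (rule nn_integral_distr) measurable
      finally show ?thesis .
    qed
    note eq = this
    show "P ?A"
      unfolding P_def det
    proof (intro impI ballI)
      fix f :: "real^'n \<Rightarrow> ennreal" assume "f \<in> borel_measurable borel"
      from eq[OF this] show "(\<integral>\<^sup>+x. f x \<partial>lborel) = ennreal 1 * (\<integral>\<^sup>+x. f (?A *v x) \<partial>lborel)"
        by (simp only: abs_one ennreal_1 mult_1)
    qed
  next
    fix m n :: 'n and c :: real assume mn: "m \<noteq> n"
    let ?A = "(\<chi> i j. if i = m \<and> j = n then c else of_bool (i = j)) :: real^'n^'n"
    have mult: "?A *v x = (\<chi> i. if i = m then x $ m + c * x $ n else x $ i)" for x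
    proof -
      have "(\<Sum>j\<in>UNIV. (if j = n then c else of_bool (m = j)) * x $ j)
          = (\<Sum>j\<in>UNIV. (if j = n then c * x $ n else 0) + (if j = m then x $ m else 0))"
        using mn by (intro sum.cong) auto
      then show ?thesis
        by (simp add: vec_eq_iff matrix_vector_mult_def sum.distrib of_bool_def if_distrib[of "\<lambda>a. a * _"] cong: if_cong)
    qed
    have "?A = (\<chi> k. if k = m then row m (mat 1) + c *s row n (mat 1) else row k (mat 1))"
      using mn by (auto simp: vec_eq_iff row_def mat_def)
    then have det: "det ?A = 1"
      using det_row_operation[OF mn, of "mat 1 :: real^'n^'n" c] by simp
    have "(\<integral>\<^sup>+x. f x \<partial>lborel) = (\<integral>\<^sup>+x. f (?A *v x) \<partial>lborel)"
      if f [measurable]: "f \<in> borel_measurable borel" for f :: "real^'n \<Rightarrow> ennreal"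
    proof -
      have "(\<integral>\<^sup>+x. f (?A *v x) \<partial>lborel) = (\<integral>\<^sup>+x. (\<integral>\<^sup>+y. f (?A *v (\<chi> i. if i = m then y else x i)) \<partial>lborel)
          \<partial>Pi\<^sub>M (UNIV - {m}) (\<lambda>_. lborel))"
        by (rule nn_integral_vec_split) measurable
      \<comment> \<open>Since \<open>n\<close> differs from \<open>m\<close>, \<open>x n\<close> is
        fixed in the inner integral, and the shear there is the translation by
        \<open>c * x n\<close>. The factor in \<open>1 * y\<close> fits the affine substitution rule
        with slope 1.\<close>
      also have "\<dots> = (\<integral>\<^sup>+x. (\<integral>\<^sup>+y. f (\<chi> i. if i = m then c * x n + 1 * y else x i) \<partial>lborel)
          \<partial>Pi\<^sub>M (UNIV - {m}) (\<lambda>_. lborel))"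
        using mn by (intro nn_integral_cong arg_cong[where f=f]) (simp add: mult vec_eq_iff)
      also have "\<dots> = (\<integral>\<^sup>+x. (\<integral>\<^sup>+y. f (\<chi> i. if i = m then y else x i) \<partial>lborel)
          \<partial>Pi\<^sub>M (UNIV - {m}) (\<lambda>_. lborel))"
      proof (rule nn_integral_cong)
        fix x :: "'n \<Rightarrow> real"
        have "(\<integral>\<^sup>+y. f (\<chi> i. if i = m then y else x i) \<partial>lborel)
            = ennreal \<bar>1\<bar> * (\<integral>\<^sup>+y. f (\<chi> i. if i = m then c * x n + 1 * y else x i) \<partial>lborel)"
          by (rule nn_integral_real_affine, rule measurable_compose[OF borel_measurable_vec_lambda f])
             (rule measurable_If, auto)
        then show "(\<integral>\<^sup>+y. f (\<chi> i. if i = m then c * x n + 1 * y else x i) \<partial>lborel)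
            = (\<integral>\<^sup>+y. f (\<chi> i. if i = m then y else x i) \<partial>lborel)"
          by (simp only: abs_one ennreal_1 mult_1)
      qed
      also have "\<dots> = (\<integral>\<^sup>+x. f x \<partial>lborel)"
        by (rule nn_integral_vec_split[symmetric]) measurable
      finally show ?thesis ..
    qed
    note eq = this
    show "P ?A"
      unfolding P_def det
    proof (intro impI ballI)
      fix f :: "real^'n \<Rightarrow> ennreal" assume "f \<in> borel_measurable borel"
      from eq[OF this] show "(\<integral>\<^sup>+x. f x \<partial>lborel) = ennreal \<bar>1\<bar> * (\<integral>\<^sup>+x. f (?A *v x) \<partial>lborel)"
        by (simp only: abs_one ennreal_1 mult_1)
    qed
  qed
  with assms show ?thesis
    unfolding P_def by blast
qed

text \<open>Stating the substitution for the measure itself, not only for nonnegative integrands,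
  lets it transfer Bochner integrals through \<open>distr\<close> and
  \<open>density\<close>.\<close>

lemma lborel_linear_image:
  fixes A :: "real^'n^'n"
  assumes "det A \<noteq> 0"
  shows "lborel = density (distr lborel borel (\<lambda>x. t + A *v x)) (\<lambda>_. ennreal \<bar>det A\<bar>)"
proof (rule measure_eqI)
  fix X :: "(real^'n) set" assume "X \<in> sets lborel"
  then have [measurable]: "X \<in> sets borel" by simp
  have "emeasure lborel X = (\<integral>\<^sup>+x. indicator X x \<partial>distr lborel borel ((+) t))"
    by (simp add: lborel_distr_plus)
  also have "\<dots> = (\<integral>\<^sup>+x. indicator X (t + x) \<partial>lborel)"
    by (subst nn_integral_distr) simp_all
  also have "\<dots> = ennreal \<bar>det A\<bar> * (\<integral>\<^sup>+x. indicator X (t + A *v x) \<partial>lborel)"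
    by (rule nn_integral_linear_image[OF assms]) measurable
  also have "\<dots> = ennreal \<bar>det A\<bar> * (\<integral>\<^sup>+x. indicator X x \<partial>distr lborel borel (\<lambda>x. t + A *v x))"
    by (subst nn_integral_distr) simp_all
  also have "\<dots> = emeasure (density (distr lborel borel (\<lambda>x. t + A *v x)) (\<lambda>_. ennreal \<bar>det A\<bar>)) X"
    by (simp add: emeasure_density nn_integral_cmult)
  finally show "emeasure lborel X = emeasure (density (distr lborel borel (\<lambda>x. t + A *v x)) (\<lambda>_. ennreal \<bar>det A\<bar>)) X" .
qed simp

text \<open>The implication starts from the transformed side: integrability is known in standardised
  coordinates and has to be carried back to \<open>f\<close>.\<close>

lemma has_bochner_integral_linear_image:
  fixes A :: "real^'n^'n" and f :: "real^'n \<Rightarrow> real"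
  assumes det: "det A \<noteq> 0" and [measurable]: "f \<in> borel_measurable borel"
    and int: "has_bochner_integral lborel (\<lambda>x. \<bar>det A\<bar> * f (t + A *v x)) v"
  shows "has_bochner_integral lborel f v"
proof -
  have "has_bochner_integral lborel (\<lambda>x. (\<lambda>x. \<bar>det A\<bar> * f x) (t + A *v x)) v"
    using int by simp
  then have "has_bochner_integral (distr lborel borel (\<lambda>x. t + A *v x)) (\<lambda>x. \<bar>det A\<bar> *\<^sub>R f x) v"
    by (simp add: has_bochner_integral_distr)
  then have "has_bochner_integral (density (distr lborel borel (\<lambda>x. t + A *v x)) (\<lambda>_. ennreal \<bar>det A\<bar>)) f v"
    by (intro has_bochner_integral_density) auto
  then show ?thesis
    by (simp flip: lborel_linear_image[OF det])
qed

lemma has_bochner_integral_vec_prod: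
  fixes f :: "'n::finite \<Rightarrow> real \<Rightarrow> real"
  assumes int: "\<And>i. has_bochner_integral lborel (f i) (v i)"
  shows "has_bochner_integral lborel (\<lambda>x::real^'n. \<Prod>i\<in>UNIV. f i (x $ i)) (\<Prod>i\<in>UNIV. v i)"
proof -
  interpret product_sigma_finite "\<lambda>_::'n. lborel :: real measure" ..
  have [measurable]: "f i \<in> borel_measurable borel" for i
    using int[of i] by (auto simp: has_bochner_integral_iff dest: borel_measurable_integrable)
  have int': "integrable lborel (f i)" "integral\<^sup>L lborel (f i) = v i" for i
    using int[of i] by (auto simp: has_bochner_integral_iff)
  have "has_bochner_integral (Pi\<^sub>M UNIV (\<lambda>_. lborel)) (\<lambda>g. \<Prod>i\<in>UNIV. f i (g i)) (\<Prod>i\<in>UNIV. v i)"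
    using product_integrable_prod[of UNIV f] product_integral_prod[of UNIV f]
    by (simp add: has_bochner_integral_iff int')
  then show ?thesis
    by (subst lborel_vec_eq_distr, subst has_bochner_integral_distr) auto
qed

subsection \<open>Gaussian vectors\<close>

lemma matrix_inv_unique:
  fixes M :: "real^'n^'n"
  assumes "M ** N = mat 1"
  shows "matrix_inv M = N"
proof -
  have "M ** N = mat 1 \<and> N ** M = mat 1"
    using assms matrix_left_right_inverse[of M N] by simp
  then have "M ** matrix_inv M = mat 1 \<and> matrix_inv M ** M = mat 1"
    unfolding matrix_inv_def by (rule someI)
  then have "matrix_inv M = matrix_inv M ** (M ** N)"
    using assms by simp
  also have "\<dots> = N"
    using \<open>M ** matrix_inv M = mat 1 \<and> matrix_inv M ** M = mat 1\<close> by (simp add: matrix_mul_assoc)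
  finally show ?thesis .
qed

lemma matrix_inv_mult:
  fixes M :: "real^'n^'n"
  assumes "invertible M"
  shows "M ** matrix_inv M = mat 1" "matrix_inv M ** M = mat 1"
proof -
  obtain N where N: "M ** N = mat 1" "N ** M = mat 1"
    using assms by (auto simp: invertible_def)
  then show "M ** matrix_inv M = mat 1" "matrix_inv M ** M = mat 1"
    by (simp_all add: matrix_inv_unique)
qed

lemma inner_symmetric_matrix:
  fixes S :: "real^'n^'n"
  assumes "transpose S = S"
  shows "x \<bullet> (S *v y) = y \<bullet> (S *v x)"
  by (metis assms dot_lmul_matrix inner_commute vector_transpose_matrix)

lemma sym_pd_invertible: "sym_pd S \<Longrightarrow> invertible S"
  unfolding invertible_left_inverse matrix_left_invertible_ker sym_pd_def
  by (metis inner_zero_right less_irrefl)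

text \<open>
  Extending the normalised vector \<open>c\<close> to a basis that is orthonormal for \<open>S\<close> makes \<open>c \<bullet> (L *v z)\<close>
  a multiple of a single coordinate of \<open>z\<close>.
\<close>

lemma sym_pd_factorization:
  fixes S :: "real^'n^'n"
  assumes S: "sym_pd S" and c: "c \<noteq> 0"
  obtains L :: "real^'n^'n" and k where "S = L ** transpose L"
    "transpose L *v c = sqrt (c \<bullet> (S *v c)) *\<^sub>R axis k 1"
proof -
  define ip where "ip x y = x \<bullet> (S *v y)" for x y
  have sym: "transpose S = S" and pos: "x \<noteq> 0 \<Longrightarrow> ip x x > 0" for x
    using S by (auto simp: sym_pd_def ip_def)
  have ip_commute: "ip x y = ip y x" for x y
    unfolding ip_def by (rule inner_symmetric_matrix[OF sym])
  have ip_scaleR: "ip x (r *\<^sub>R y) = r * ip x y" "ip (r *\<^sub>R x) y = r * ip x y" for x y r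
    by (simp_all add: ip_def matrix_vector_mult_scaleR)
  have ip_diff: "ip x (y - z) = ip x y - ip x z" for x y z
    by (simp add: ip_def matrix_vector_mult_diff_distrib inner_diff_right)
  have ip_sum: "ip x (\<Sum>e\<in>E. g e) = (\<Sum>e\<in>E. ip x (g e))" for x g and E :: "(real^'n) set"
    by (simp add: ip_def inner_sum_right linear_sum[OF matrix_vector_mul_linear])
  define orth where "orth E \<longleftrightarrow> (\<forall>x\<in>E. \<forall>y\<in>E. ip x y = of_bool (x = y))" for E
  have indep: "independent E" if "orth E" for E
  proof
    assume "dependent E"
    then obtain t u v where t: "finite t" "t \<subseteq> E" "(\<Sum>v\<in>t. u v *\<^sub>R v) = 0" "v \<in> t" "u v \<noteq> 0"
      unfolding dependent_explicit by blast
    have "0 = ip v (\<Sum>v\<in>t. u v *\<^sub>R v)"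
      by (simp add: t ip_def)
    also have "\<dots> = (\<Sum>w\<in>t. u w * of_bool (v = w))"
      unfolding ip_sum ip_scaleR using that t by (intro sum.cong) (auto simp: orth_def subset_iff)
    also have "\<dots> = u v"
      using t by (simp add: of_bool_def if_distrib cong: if_cong)
    finally show False using t by simp
  qed
  define c0 where "c0 = (1 / sqrt (ip c c)) *\<^sub>R c"
  have ip_cc: "ip c c > 0"
    using c by (rule pos)
  have "ip c0 c0 = 1"
    using ip_cc by (simp add: c0_def ip_scaleR field_simps)
  then have "orth {c0} \<and> c0 \<in> {c0}"
    by (simp add: orth_def)
  \<comment> \<open>Orthonormal sets are independent, so their cardinalities are bounded by the
    dimension, and one of maximal size containing \<open>c0\<close> exists.\<close>
  moreover have "card E < Suc (DIM(real^'n))" if "orth E \<and> c0 \<in> E" for E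
    using that indep[of E] independent_bound[of E] by simp
  ultimately obtain E where E: "orth E" "c0 \<in> E" and max: "\<And>F. orth F \<and> c0 \<in> F \<Longrightarrow> card F \<le> card E"
    using ex_has_greatest_nat[of "\<lambda>E. orth E \<and> c0 \<in> E" "{c0}" card "Suc (DIM(real^'n))"]
    by (metis less_imp_le)
  have fin: "finite E"
    using indep[OF E(1)] by (rule independent_imp_finite)
  have span: "span E = UNIV"
  proof (rule ccontr)
    assume "span E \<noteq> UNIV"
    then obtain x where x: "x \<notin> span E" by auto
    \<comment> \<open>Gram-Schmidt residual of \<open>x\<close>: once normalised, it would enlarge
      the maximal set.\<close>
    define w where "w = x - (\<Sum>e\<in>E. ip e x *\<^sub>R e)"
    have "(\<Sum>e\<in>E. ip e x *\<^sub>R e) \<in> span E"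
      by (intro span_sum span_scale span_base)
    with x have "w \<noteq> 0" by (auto simp: w_def)
    have "ip e w = 0" if "e \<in> E" for e
    proof -
      have "ip e (\<Sum>e\<in>E. ip e x *\<^sub>R e) = (\<Sum>e'\<in>E. ip e' x * of_bool (e = e'))"
        unfolding ip_sum ip_scaleR using E that by (intro sum.cong) (auto simp: orth_def)
      also have "\<dots> = ip e x"
        using that fin by (simp add: of_bool_def if_distrib cong: if_cong)
      finally show ?thesis by (simp add: w_def ip_diff)
    qed
    moreover define w' where "w' = (1 / sqrt (ip w w)) *\<^sub>R w"
    ultimately have w': "ip w' w' = 1" "\<And>e. e \<in> E \<Longrightarrow> ip e w' = 0"
      using pos[OF \<open>w \<noteq> 0\<close>] by (simp_all add: w'_def ip_scaleR field_simps)
    then have "w' \<notin> E" by force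
    moreover have "ip w' e = 0" if "e \<in> E" for e
      using w'(2)[OF that] ip_commute by metis
    ultimately have "orth (insert w' E)"
      using E w' by (auto simp: orth_def)
    then have "card (insert w' E) \<le> card E"
      using E by (intro max) auto
    then show False
      using fin \<open>w' \<notin> E\<close> by simp
  qed
  have "card E = CARD('n)"
    using dim_eq_card[of E UNIV] indep[OF E(1)] span by (simp add: dim_UNIV)
  then obtain f where f: "bij_betw f (UNIV :: 'n set) E"
    using finite_same_card_bij[of "UNIV :: 'n set" E] fin by auto
  then obtain k where k: "f k = c0"
    using E(2) by (auto simp: bij_betw_def)
  have ip_f: "ip (f i) (f j) = of_bool (i = j)" for i j
    using f E(1) by (auto simp: orth_def bij_betw_def inj_def)
  \<comment> \<open>The columns of \<open>P\<close> are orthonormal for \<open>S\<close>, that is,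
    \<open>transpose P ** S ** P = mat 1\<close>. Hence
    \<open>P ** transpose P ** S = mat 1\<close>, and \<open>L = S ** P\<close> is the required
    factor.\<close>
  define P where "P = (\<chi> i j. f j $ i)"
  have PT: "transpose P *v x = (\<chi> i. f i \<bullet> x)" for x
    by (simp add: P_def vec_eq_iff transpose_def matrix_vector_mult_def inner_vec_def)
  have "(transpose P ** S) *v (P *v axis j 1) = axis j 1" for j
  proof -
    have "P *v axis j 1 = f j"
      by (simp add: P_def vec_eq_iff matrix_vector_mult_def axis_def if_distrib cong: if_cong)
    then have "(transpose P ** S) *v (P *v axis j 1) = (\<chi> i. ip (f i) (f j))"
      by (simp only: PT ip_def matrix_vector_mul_assoc[symmetric])
    then show ?thesis
      by (simp add: ip_f axis_def of_bool_def vec_eq_iff)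
  qed
  then have "column j ((transpose P ** S) ** P) = axis j 1" for j
    by (simp only: matrix_vector_mul_assoc matrix_vector_mult_basis[symmetric])
  then have "((transpose P ** S) ** P) $ i $ j = mat 1 $ i $ j" for i j
    by (simp add: column_def vec_eq_iff axis_def mat_def)
  then have "(transpose P ** S) ** P = mat 1"
    by (simp add: vec_eq_iff)
  then have "P ** transpose P ** S = mat 1"
    using matrix_left_right_inverse[of "transpose P ** S" P] by (simp add: matrix_mul_assoc)
  then have "S = (S ** P) ** transpose (S ** P)"
    by (metis matrix_transpose_mul matrix_mul_assoc matrix_mul_rid sym)
  moreover have "transpose (S ** P) *v c = sqrt (c \<bullet> (S *v c)) *\<^sub>R axis k 1"
  proof -
    \<comment> \<open>\<open>c\<close> is a multiple of the basis vector \<open>f k\<close>, so it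
      is orthogonal for \<open>S\<close> to all the others.\<close>
    have "c = sqrt (ip c c) *\<^sub>R f k"
      using ip_cc by (simp add: k c0_def)
    then have "ip (f i) c = sqrt (ip c c) * of_bool (i = k)" for i
      by (metis ip_f ip_scaleR(1))
    then show ?thesis
      by (simp only: matrix_transpose_mul sym PT matrix_vector_mul_assoc[symmetric] ip_def[symmetric])
         (simp add: vec_eq_iff axis_def of_bool_def)
  qed
  ultimately show ?thesis ..
qed

section \<open>Integrals and moments of Gaussian vectors\<close>

lemma borel_measurable_mvn_density [measurable]: "mvn_density mu S \<in> borel_measurable borel"
  unfolding mvn_density_def by measurable

text \<open>In the coordinates \<open>z\<close> the components are independent standard normals:
  \<open>transpose L ** matrix_inv S ** L\<close> is the identity, and \<open>det S\<close> is the
  square of \<open>det L\<close>, which cancels the Jacobian.\<close>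

lemma mvn_density_factorization:
  fixes L :: "real^'n^'n"
  assumes S: "sym_pd S" "S = L ** transpose L"
  shows "det L \<noteq> 0"
    and "\<bar>det L\<bar> * mvn_density mu S (mu + L *v z) = (\<Prod>i\<in>UNIV. std_normal_density (z $ i))"
proof -
  have inv: "invertible S"
    using S(1) by (rule sym_pd_invertible)
  have det: "det S = (det L)\<^sup>2"
    by (simp add: S(2) det_mul power2_eq_square)
  with inv show nz: "det L \<noteq> 0"
    by (auto simp: invertible_det_nz)
  \<comment> \<open>A right inverse of the square matrix \<open>L\<close> is also a left
    inverse.\<close>
  have "L ** (transpose L ** matrix_inv S) = mat 1"
    using matrix_inv_mult(1)[OF inv] by (simp add: S(2) matrix_mul_assoc)
  then have "transpose L ** matrix_inv S ** L = mat 1"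
    by (simp add: matrix_left_right_inverse)
  then have "transpose L *v (matrix_inv S *v (L *v z)) = z"
    by (simp add: matrix_vector_mul_assoc matrix_mul_assoc)
  then have quad: "(L *v z) \<bullet> (matrix_inv S *v (L *v z)) = z \<bullet> z"
    by (metis dot_lmul_matrix inner_commute vector_transpose_matrix)
  have "(\<Prod>i\<in>UNIV. std_normal_density (z $ i)) = exp (\<Sum>i\<in>UNIV. - (z $ i)\<^sup>2 / 2) / sqrt (2 * pi) ^ CARD('n)"
    by (simp add: std_normal_density_def prod_dividef exp_sum)
  also have "(\<Sum>i\<in>UNIV. - (z $ i)\<^sup>2 / 2) = - (z \<bullet> z) / 2"
    by (simp add: inner_vec_def power2_eq_square sum_negf sum_divide_distrib)
  also have "exp (- (z \<bullet> z) / 2) / sqrt (2 * pi) ^ CARD('n) = \<bar>det L\<bar> * mvn_density mu S (mu + L *v z)"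
  proof -
    have "sqrt ((2 * pi) ^ CARD('n) * det S) = sqrt (2 * pi) ^ CARD('n) * \<bar>det L\<bar>"
      unfolding det by (simp only: real_sqrt_mult[of "_ ^ _" "_\<^sup>2"] real_sqrt_abs real_sqrt_power[of "2 * pi"])
    then show ?thesis
      using nz by (simp add: mvn_density_def quad)
  qed
  finally show "\<bar>det L\<bar> * mvn_density mu S (mu + L *v z) = (\<Prod>i\<in>UNIV. std_normal_density (z $ i))" ..
qed

lemma has_bochner_integral_std_normal: "has_bochner_integral lborel std_normal_density 1"
  by (simp add: has_bochner_integral_iff)

text \<open>Choosing \<open>L\<close> adapted to \<open>c\<close> makes \<open>c \<bullet> b\<close>
  depend on the single coordinate \<open>z $ k\<close>; the other coordinates integrate to 1.
  Integrability is carried along, so a loss known to be integrable in one dimension can be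
  handled.\<close>

lemma mvn_linear_functional:
  fixes S :: "real^'n^'n" and f :: "real \<Rightarrow> real"
  assumes S: "sym_pd S" and f [measurable]: "f \<in> borel_measurable borel"
    and int: "has_bochner_integral lborel (\<lambda>z. std_normal_density z * f (c \<bullet> mu + sqrt (c \<bullet> (S *v c)) * z)) v"
  shows "has_bochner_integral lborel (\<lambda>b. mvn_density mu S b * f (c \<bullet> b)) v"
proof -
  have *: "has_bochner_integral lborel (\<lambda>b. mvn_density mu S b * f (c \<bullet> b)) v"
    if c: "c \<noteq> 0" and [measurable]: "f \<in> borel_measurable borel"
      and int: "has_bochner_integral lborel (\<lambda>z. std_normal_density z * f (c \<bullet> mu + sqrt (c \<bullet> (S *v c)) * z)) v"
    for c :: "real^'n" and f :: "real \<Rightarrow> real"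
  proof -
    obtain L :: "real^'n^'n" and k where L: "S = L ** transpose L" and k: "transpose L *v c = sqrt (c \<bullet> (S *v c)) *\<^sub>R axis k 1"
      using sym_pd_factorization[OF S c] .
    define g :: "'n \<Rightarrow> real \<Rightarrow> real" where "g i z = (if i = k then std_normal_density z * f (c \<bullet> mu + sqrt (c \<bullet> (S *v c)) * z)
      else std_normal_density z)" for i z
    have "has_bochner_integral lborel (\<lambda>z::real^'n. \<Prod>i\<in>UNIV. g i (z $ i)) (\<Prod>i\<in>UNIV. if i = k then v else 1)"
      using int has_bochner_integral_std_normal
      by (intro has_bochner_integral_vec_prod) (simp add: g_def[abs_def])
    moreover have "(\<Prod>i\<in>UNIV. g i (z $ i)) = \<bar>det L\<bar> * (mvn_density mu S (mu + L *v z) * f (c \<bullet> (mu + L *v z)))"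
      for z :: "real^'n"
    proof -
      have "c \<bullet> (L *v z) = sqrt (c \<bullet> (S *v c)) * z $ k"
        by (metis k dot_lmul_matrix vector_transpose_matrix transpose_transpose inner_scaleR_left inner_axis' mult_1 inner_real_def)
      then have "f (c \<bullet> mu + sqrt (c \<bullet> (S *v c)) * z $ k) = f (c \<bullet> (mu + L *v z))"
        by (simp add: inner_add_right)
      moreover have "(\<Prod>i\<in>UNIV. g i (z $ i)) = (\<Prod>i\<in>UNIV. std_normal_density (z $ i)) * f (c \<bullet> mu + sqrt (c \<bullet> (S *v c)) * z $ k)"
        by (simp add: prod.remove[of UNIV k] g_def)
      ultimately show ?thesis
        by (simp add: mvn_density_factorization(2)[OF S L, symmetric] mult.assoc)
    qed
    ultimately have "has_bochner_integral lborel
        (\<lambda>z. \<bar>det L\<bar> * (mvn_density mu S (mu + L *v z) * f (c \<bullet> (mu + L *v z)))) v"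
      by simp
    then show ?thesis
      by (rule has_bochner_integral_linear_image[OF mvn_density_factorization(1)[OF S L] _, rotated]) measurable
  qed
  show ?thesis
  proof (cases "c = 0")
    case True
    \<comment> \<open>No basis can be adapted to \<open>c = 0\<close>, but then
      \<open>f (c \<bullet> b)\<close> is the constant \<open>f 0\<close>, which is a function of
      any nonzero functional.\<close>
    have "has_bochner_integral lborel (\<lambda>b. mvn_density mu S b * (\<lambda>_. f 0) ((axis undefined 1 :: real^'n) \<bullet> b)) v"
      using int True by (intro *) (auto simp: axis_eq_0_iff)
    with True show ?thesis by simp
  qed (use int in \<open>auto intro: *\<close>)
qed

lemma mvn_integral: "sym_pd S \<Longrightarrow> has_bochner_integral lborel (mvn_density mu S) 1"
  using mvn_linear_functional[of S "\<lambda>_. 1" 0 mu 1] has_bochner_integral_std_normal by simp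

lemma mvn_square_moment:
  assumes S: "sym_pd S"
  shows "has_bochner_integral lborel (\<lambda>b. mvn_density mu S b * (c \<bullet> b)\<^sup>2) ((c \<bullet> mu)\<^sup>2 + c \<bullet> (S *v c))"
proof (rule mvn_linear_functional[OF S, where f="\<lambda>x. x\<^sup>2"])
  let ?m = "c \<bullet> mu"
  define s where "s = sqrt (c \<bullet> (S *v c))"
  have s2: "c \<bullet> (S *v c) = s\<^sup>2"
    using S by (cases "c = 0") (auto simp: sym_pd_def less_imp_le s_def)
  \<comment> \<open>Expansion of the square. The exponents \<open>2 * 0 + 1\<close> and
    \<open>2 * 1\<close> have the shapes of the odd and even moment rules, and the quotient of
    factorials is 1.\<close>
  have "has_bochner_integral lborel (\<lambda>z. ?m\<^sup>2 * std_normal_density z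
      + (2 * ?m * s) * (std_normal_density z * z ^ (2 * 0 + 1)) + s\<^sup>2 * (std_normal_density z * z ^ (2 * 1)))
      (?m\<^sup>2 * 1 + (2 * ?m * s) * 0 + s\<^sup>2 * (fact (2 * 1) / (2 ^ 1 * fact 1)))"
    by (intro has_bochner_integral_add has_bochner_integral_mult_right std_normal_moment_even
        std_normal_moment_odd has_bochner_integral_std_normal)
  then show "has_bochner_integral lborel (\<lambda>z. std_normal_density z * (?m + sqrt (c \<bullet> (S *v c)) * z)\<^sup>2) (?m\<^sup>2 + c \<bullet> (S *v c))"
    unfolding s_def[symmetric] unfolding s2 by (simp add: power2_eq_square algebra_simps)
qed simp

text \<open>Polarisation: the product is a quarter of the difference of the squares for
  \<open>a + c\<close> and \<open>a - c\<close>. Symmetry of \<open>S\<close> merges the two mixed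
  terms.\<close>

lemma mvn_product_moment:
  assumes S: "sym_pd S"
  shows "has_bochner_integral lborel (\<lambda>b. mvn_density mu S b * ((a \<bullet> b) * (c \<bullet> b)))
    ((a \<bullet> mu) * (c \<bullet> mu) + a \<bullet> (S *v c))"
proof -
  have sym: "c \<bullet> (S *v a) = a \<bullet> (S *v c)"
    using S by (intro inner_symmetric_matrix) (simp add: sym_pd_def)
  have "has_bochner_integral lborel
     (\<lambda>b. 1/4 * (mvn_density mu S b * ((a + c) \<bullet> b)\<^sup>2 - mvn_density mu S b * ((a - c) \<bullet> b)\<^sup>2))
     (1/4 * ((((a + c) \<bullet> mu)\<^sup>2 + (a + c) \<bullet> (S *v (a + c))) - (((a - c) \<bullet> mu)\<^sup>2 + (a - c) \<bullet> (S *v (a - c)))))"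
    by (intro has_bochner_integral_mult_right has_bochner_integral_diff mvn_square_moment S)
  moreover have "1/4 * ((((a + c) \<bullet> mu)\<^sup>2 + (a + c) \<bullet> (S *v (a + c))) - (((a - c) \<bullet> mu)\<^sup>2 + (a - c) \<bullet> (S *v (a - c))))
      = (a \<bullet> mu) * (c \<bullet> mu) + a \<bullet> (S *v c)" (is "?l = _")
    by (simp add: inner_add_left inner_diff_left inner_add_right inner_diff_right matrix_vector_right_distrib
        matrix_vector_mult_diff_distrib sym power2_eq_square field_simps)
  moreover have "1/4 * (mvn_density mu S b * ((a + c) \<bullet> b)\<^sup>2 - mvn_density mu S b * ((a - c) \<bullet> b)\<^sup>2)
      = mvn_density mu S b * ((a \<bullet> b) * (c \<bullet> b))" for b
    by (simp add: inner_add_left inner_diff_left power2_eq_square field_simps)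
  ultimately show ?thesis by (simp only:)
qed

lemma inner_matrix_eq_sum:
  fixes M :: "real^'n^'n"
  shows "b \<bullet> (M *v b) = (\<Sum>i\<in>UNIV. \<Sum>j\<in>UNIV. M $ i $ j * (b $ i * b $ j))"
  by (simp add: inner_vec_def matrix_vector_mult_def sum_distrib_left algebra_simps)

text \<open>For symmetric \<open>S\<close> the double sum is \<open>trace (M ** S)\<close>; it is
  the part that does not depend on the mean.\<close>

lemma mvn_quadratic_form:
  fixes S M :: "real^'n^'n"
  assumes S: "sym_pd S"
  shows "has_bochner_integral lborel (\<lambda>b. mvn_density mu S b * (b \<bullet> (M *v b)))
    (mu \<bullet> (M *v mu) + (\<Sum>i\<in>UNIV. \<Sum>j\<in>UNIV. M $ i $ j * S $ i $ j))"
proof -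
  have S_ij: "axis i 1 \<bullet> (S *v axis j 1) = S $ i $ j" for i j
    by (simp add: inner_axis' matrix_vector_mult_basis column_def)
  have "has_bochner_integral lborel (\<lambda>b. \<Sum>i\<in>UNIV. \<Sum>j\<in>UNIV. M $ i $ j *
        (mvn_density mu S b * ((axis i 1 \<bullet> b) * (axis j 1 \<bullet> b))))
     (\<Sum>i\<in>UNIV. \<Sum>j\<in>UNIV. M $ i $ j * ((axis i 1 \<bullet> mu) * (axis j 1 \<bullet> mu) + axis i 1 \<bullet> (S *v axis j 1)))"
    by (intro has_bochner_integral_sum has_bochner_integral_mult_right mvn_product_moment S)
  then show ?thesis
    unfolding S_ij by (simp add: inner_axis' inner_matrix_eq_sum sum_distrib_left distrib_left sum.distrib mult.left_commute)
qed

subsection \<open>Gaussian smoothing\<close>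

text \<open>Serves to dominate the difference quotients of \<open>exp (s * x)\<close> in
  \<open>s\<close>. Both signs of \<open>y\<close> come from
  \<open>1 + y \<le> exp y\<close>.\<close>

lemma abs_exp_minus_one_le: "\<bar>exp y - 1\<bar> \<le> \<bar>y\<bar> * exp \<bar>y :: real\<bar>"
proof (cases "y \<ge> 0")
  case True
  have "exp y * (1 - exp (- y)) \<le> exp y * y"
    using exp_ge_add_one_self[of "- y"] by (intro mult_left_mono) auto
  with True show ?thesis
    by (simp add: right_diff_distrib mult_ac flip: exp_add)
next
  case False
  have "1 - exp y \<le> - y"
    using exp_ge_add_one_self[of y] by linarith
  also have "\<dots> \<le> - y * exp (- y)"
    using False by (intro mult_le_cancel_left1[THEN iffD2]) auto
  finally show ?thesis
    using False by (simp add: abs_if)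
qed

lemma abs_le_exp_sum: "\<bar>x :: real\<bar> \<le> exp x + exp (- x)"
  using exp_ge_add_one_self[of x] exp_ge_add_one_self[of "- x"] exp_gt_zero[of x] exp_gt_zero[of "- x"]
  by linarith

text \<open>The factor \<open>x\<close> is absorbed by \<open>exp x + exp (- x)\<close>, at the cost
  of moving \<open>s\<close> by 1 in either direction; this is why the hypothesis ranges over all
  real \<open>s\<close>.\<close>

lemma laplace_transform_moment_integrable:
  fixes g :: "real \<Rightarrow> real"
  assumes int: "\<And>s. integrable lborel (\<lambda>x. g x * exp (s * x))"
  shows "integrable lborel (\<lambda>x. x * g x * exp (s * x))"
proof (rule Bochner_Integration.integrable_bound)
  have [measurable]: "g \<in> borel_measurable borel"
    using borel_measurable_integrable[OF int[of 0]] by simp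
  show "(\<lambda>x. x * g x * exp (s * x)) \<in> borel_measurable lborel"
    by measurable
  show "integrable lborel (\<lambda>x. norm (g x * exp ((s + 1) * x)) + norm (g x * exp ((s - 1) * x)))"
    by (intro Bochner_Integration.integrable_add integrable_norm int)
  have "norm (x * g x * exp (s * x)) \<le> norm (g x * exp ((s + 1) * x)) + norm (g x * exp ((s - 1) * x))" for x
  proof -
    have "norm (x * g x * exp (s * x)) = \<bar>x\<bar> * (\<bar>g x\<bar> * exp (s * x))"
      by (simp add: abs_mult)
    also have "\<dots> \<le> (exp x + exp (- x)) * (\<bar>g x\<bar> * exp (s * x))"
      by (intro mult_right_mono abs_le_exp_sum) auto
    also have "\<dots> = norm (g x * exp ((s + 1) * x)) + norm (g x * exp ((s - 1) * x))"
      by (simp add: abs_mult algebra_simps exp_add exp_diff exp_minus field_simps)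
    finally show ?thesis .
  qed
  then show "AE x in lborel. norm (x * g x * exp (s * x))
      \<le> norm (norm (g x * exp ((s + 1) * x)) + norm (g x * exp ((s - 1) * x)))"
    by (intro AE_I2) simp
qed

lemma laplace_transform_has_derivative:
  fixes g :: "real \<Rightarrow> real"
  assumes int: "\<And>s. integrable lborel (\<lambda>x. g x * exp (s * x))"
  shows "((\<lambda>s. LINT x|lborel. g x * exp (s * x)) has_real_derivative
    (LINT x|lborel. x * g x * exp (s * x))) (at s)"
proof -
  have [measurable]: "g \<in> borel_measurable borel"
    using borel_measurable_integrable[OF int[of 0]] by simp
  let ?q = "\<lambda>h x. g x * exp (s * x) * ((exp (h * x) - 1) / h)"
  \<comment> \<open>In a difference quotient with \<open>\<bar>h\<bar> \<le> 1\<close>, one factor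
    \<open>exp \<bar>x\<bar>\<close> bounds \<open>\<bar>x\<bar>\<close> and another bounds
    \<open>exp \<bar>h * x\<bar>\<close>, whence the shifts by 2.\<close>
  let ?w = "\<lambda>x. norm (g x * exp ((s + 2) * x)) + norm (g x * exp ((s - 2) * x))"
  have q: "((LINT x|lborel. g x * exp ((s + h) * x)) - (LINT x|lborel. g x * exp (s * x))) / h
      = (LINT x|lborel. ?q h x)" for h
  proof -
    have "((LINT x|lborel. g x * exp ((s + h) * x)) - (LINT x|lborel. g x * exp (s * x))) / h
        = (LINT x|lborel. (g x * exp ((s + h) * x) - g x * exp (s * x)) / h)"
      by (simp add: Bochner_Integration.integral_diff[OF int int])
    also have "(\<lambda>x. (g x * exp ((s + h) * x) - g x * exp (s * x)) / h) = ?q h"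
      by (simp add: fun_eq_iff algebra_simps exp_add diff_divide_distrib)
    finally show ?thesis .
  qed
  have bound: "norm (?q h x) \<le> ?w x" if h: "h \<noteq> 0" "\<bar>h\<bar> \<le> 1" for h x
  proof -
    have "\<bar>(exp (h * x) - 1) / h\<bar> \<le> \<bar>x\<bar> * exp \<bar>h * x\<bar>"
      using abs_exp_minus_one_le[of "h * x"] h by (simp add: abs_mult field_simps)
    also have "\<dots> \<le> exp \<bar>x\<bar> * exp \<bar>x\<bar>"
      using h exp_ge_add_one_self[of "\<bar>x\<bar>"]
      by (intro mult_mono) (auto simp: abs_mult mult_left_le_one_le simp del: exp_ge_add_one_self)
    also have "\<dots> = exp (2 * \<bar>x\<bar>)"
      by (simp flip: exp_add)
    also have "\<dots> \<le> exp (2 * x) + exp (- 2 * x)"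
      by (auto simp: abs_if)
    finally have "\<bar>g x * exp (s * x)\<bar> * \<bar>(exp (h * x) - 1) / h\<bar>
        \<le> \<bar>g x * exp (s * x)\<bar> * (exp (2 * x) + exp (- 2 * x))"
      by (intro mult_left_mono) auto
    also have "\<dots> = ?w x"
      by (simp add: abs_mult algebra_simps exp_add exp_diff exp_minus field_simps)
    finally show ?thesis by (simp add: abs_mult)
  qed
  have w: "integrable lborel ?w"
    by (intro Bochner_Integration.integrable_add integrable_norm int)
  have "((\<lambda>h. LINT x|lborel. ?q h x) \<longlongrightarrow> (LINT x|lborel. x * g x * exp (s * x))) (at 0)"
    unfolding tendsto_at_iff_sequentially
  proof (intro allI impI)
    fix X :: "nat \<Rightarrow> real" assume X: "\<forall>i. X i \<in> UNIV - {0}" "X \<longlonglongrightarrow> 0"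
    \<comment> \<open>Dominated convergence is applied along a sequence whose terms satisfy the
      bound only from some \<open>N\<close> on, so the sequence is shifted by
      \<open>N\<close>.\<close>
    then obtain N where N: "\<And>n. n \<ge> N \<Longrightarrow> \<bar>X n\<bar> \<le> 1"
      using LIMSEQ_D[OF X(2), of 1] by (auto intro: less_imp_le)
    have "(\<lambda>n. LINT x|lborel. ?q (X (n + N)) x) \<longlonglongrightarrow> (LINT x|lborel. x * g x * exp (s * x))"
    proof (rule integral_dominated_convergence[OF _ _ w])
      show "AE x in lborel. (\<lambda>n. ?q (X (n + N)) x) \<longlonglongrightarrow> x * g x * exp (s * x)"
      proof (rule AE_I2)
        fix x :: real
        have "((\<lambda>h. exp (h * x)) has_real_derivative x) (at 0)"
          by (auto intro!: derivative_eq_intros)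
        then have "((\<lambda>h. (exp (h * x) - 1) / h) \<longlongrightarrow> x) (at 0)"
          by (simp add: DERIV_def)
        moreover have "filterlim (\<lambda>n. X (n + N)) (at 0) sequentially"
          using X by (auto simp: filterlim_at intro!: LIMSEQ_ignore_initial_segment)
        ultimately have "(\<lambda>n. (exp (X (n + N) * x) - 1) / X (n + N)) \<longlonglongrightarrow> x"
          by (rule filterlim_compose)
        from tendsto_mult_left[OF this, of "g x * exp (s * x)"]
        show "(\<lambda>n. ?q (X (n + N)) x) \<longlonglongrightarrow> x * g x * exp (s * x)"
          by (simp add: mult_ac)
      qed
      show "AE x in lborel. norm (?q (X (n + N)) x) \<le> ?w x" for n
        using X(1) N[of "n + N"] by (intro AE_I2 bound) auto
    qed measurable
    then show "((\<lambda>h. LINT x|lborel. ?q h x) \<circ> X) \<longlonglongrightarrow> (LINT x|lborel. x * g x * exp (s * x))"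
      unfolding comp_def by (rule LIMSEQ_offset)
  qed
  then show ?thesis
    unfolding DERIV_def q .
qed

text \<open>
  Completing the square in \<open>\<xi>\<close> expresses the smoothed function through the Laplace transform of
  \<open>normal_density 0 \<nu> x * f x\<close>, so that no smoothness of \<open>f\<close> is needed.
\<close>

lemma gaussian_smoothing_twice_differentiable:
  fixes f :: "real \<Rightarrow> real"
  assumes \<nu>: "\<nu> > 0" and int: "\<And>m. integrable lborel (\<lambda>x. normal_density m \<nu> x * f x)"
  obtains V1 V2 where
    "\<And>\<xi>. ((\<lambda>\<xi>. LINT z|lborel. f (\<xi> + \<nu> * z) * std_normal_density z) has_real_derivative V1 \<xi>) (at \<xi>)"
    "\<And>\<xi>. (V1 has_real_derivative V2 \<xi>) (at \<xi>)"
proof -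
  \<comment> \<open>Powers of \<open>x\<close> are built into \<open>g\<close>, so that the
    differentiation step from \<open>M k\<close> to \<open>M (Suc k)\<close> can be
    iterated.\<close>
  define g where "g k x = x ^ k * (normal_density 0 \<nu> x * f x)" for k :: nat and x
  define M where "M k s = (LINT x|lborel. g k x * exp (s * x))" for k s
  have density: "normal_density 0 \<nu> x * exp (s * x) = exp (s\<^sup>2 * \<nu>\<^sup>2 / 2) * normal_density (s * \<nu>\<^sup>2) \<nu> x" for s x
  proof -
    have "- (x - 0)\<^sup>2 / (2 * \<nu>\<^sup>2) + s * x = s\<^sup>2 * \<nu>\<^sup>2 / 2 + - (x - s * \<nu>\<^sup>2)\<^sup>2 / (2 * \<nu>\<^sup>2)"
      using \<nu> by (simp add: field_simps power2_eq_square)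
    then have "exp (- (x - 0)\<^sup>2 / (2 * \<nu>\<^sup>2)) * exp (s * x)
        = exp (s\<^sup>2 * \<nu>\<^sup>2 / 2) * exp (- (x - s * \<nu>\<^sup>2)\<^sup>2 / (2 * \<nu>\<^sup>2))"
      by (metis exp_add)
    then show ?thesis
      by (simp add: normal_density_def)
  qed
  have int0: "integrable lborel (\<lambda>x. g 0 x * exp (s * x))" for s
  proof -
    have "g 0 x * exp (s * x) = exp (s\<^sup>2 * \<nu>\<^sup>2 / 2) * (normal_density (s * \<nu>\<^sup>2) \<nu> x * f x)" for x
      using density[of x s] by (simp add: g_def mult_ac)
    then show ?thesis
      using int by simp
  qed
  have g_Suc: "g (Suc k) x = x * g k x" for k x
    by (simp add: g_def)
  have int_g: "integrable lborel (\<lambda>x. g k x * exp (s * x))" for k s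
  proof (induction k arbitrary: s)
    case (Suc k)
    then show ?case
      unfolding g_Suc by (rule laplace_transform_moment_integrable)
  qed (rule int0)
  have M_deriv: "(M k has_real_derivative M (Suc k) s) (at s)" for k s
    unfolding M_def g_Suc by (rule laplace_transform_has_derivative[OF int_g])
  \<comment> \<open>With \<open>s = \<xi> / \<nu>\<^sup>2\<close>, the density
    \<open>normal_density \<xi> \<nu> x\<close> is
    \<open>E \<xi> * normal_density 0 \<nu> x * exp (s * x)\<close>.\<close>
  define E where "E \<xi> = exp (- \<xi>\<^sup>2 / (2 * \<nu>\<^sup>2))" for \<xi>
  have V: "(LINT z|lborel. f (\<xi> + \<nu> * z) * std_normal_density z) = E \<xi> * M 0 (\<xi> / \<nu>\<^sup>2)" for \<xi>
  proof -
    have "E \<xi> * (g 0 x * exp (\<xi> / \<nu>\<^sup>2 * x)) = normal_density \<xi> \<nu> x * f x" for x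
      using density[of x "\<xi> / \<nu>\<^sup>2"] \<nu>
      by (simp add: g_def E_def mult_ac power_divide power2_eq_square exp_minus field_simps)
    then have "E \<xi> * M 0 (\<xi> / \<nu>\<^sup>2) = (LINT x|lborel. normal_density \<xi> \<nu> x * f x)"
      unfolding M_def by (subst integral_mult_right_zero[symmetric]) simp
    also have "\<dots> = \<nu> * (LINT z|lborel. normal_density \<xi> \<nu> (\<xi> + \<nu> * z) * f (\<xi> + \<nu> * z))"
      using \<nu> by (subst lborel_integral_real_affine[of \<nu> _ \<xi>]) auto
    also have "\<dots> = (LINT z|lborel. f (\<xi> + \<nu> * z) * std_normal_density z)"
    proof -
      have "\<nu> * normal_density \<xi> \<nu> (\<xi> + \<nu> * z) = std_normal_density z" for z
        using \<nu> by (simp add: normal_density_def power_mult_distrib real_sqrt_mult)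
      then have "f (\<xi> + \<nu> * z) * std_normal_density z
          = \<nu> * (normal_density \<xi> \<nu> (\<xi> + \<nu> * z) * f (\<xi> + \<nu> * z))" for z
        by (metis mult.assoc mult.commute)
      then show ?thesis
        by (subst integral_mult_right_zero[symmetric]) (simp only:)
    qed
    finally show ?thesis ..
  qed
  have E_deriv: "(E has_real_derivative (- \<xi> / \<nu>\<^sup>2 * E \<xi>)) (at \<xi>)" for \<xi>
    unfolding E_def using \<nu> by (auto intro!: derivative_eq_intros simp: field_simps)
  have M_deriv': "((\<lambda>\<xi>. M k (\<xi> / \<nu>\<^sup>2)) has_real_derivative (M (Suc k) (\<xi> / \<nu>\<^sup>2) / \<nu>\<^sup>2)) (at \<xi>)" for k \<xi>
    using DERIV_chain'[OF DERIV_cdivide[OF DERIV_ident, where c="\<nu>\<^sup>2"] M_deriv[of k]] by simp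
  define V1 where "V1 \<xi> = - \<xi> / \<nu>\<^sup>2 * E \<xi> * M 0 (\<xi> / \<nu>\<^sup>2) + M 1 (\<xi> / \<nu>\<^sup>2) / \<nu>\<^sup>2 * E \<xi>" for \<xi>
  show thesis
  proof
    show "((\<lambda>\<xi>. LINT z|lborel. f (\<xi> + \<nu> * z) * std_normal_density z) has_real_derivative V1 \<xi>) (at \<xi>)" for \<xi>
      unfolding V V1_def using DERIV_mult[OF E_deriv M_deriv'[of 0]] by simp
    show "(V1 has_real_derivative
        (- \<xi> / \<nu>\<^sup>2 * E \<xi>) * (M (Suc 0) (\<xi> / \<nu>\<^sup>2) / \<nu>\<^sup>2)
          + (- \<xi> / \<nu>\<^sup>2 * (- \<xi> / \<nu>\<^sup>2 * E \<xi>) + (- 1 / \<nu>\<^sup>2) * E \<xi>) * M 0 (\<xi> / \<nu>\<^sup>2)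
          + (M 1 (\<xi> / \<nu>\<^sup>2) / \<nu>\<^sup>2 * (- \<xi> / \<nu>\<^sup>2 * E \<xi>) + M (Suc 1) (\<xi> / \<nu>\<^sup>2) / \<nu>\<^sup>2 / \<nu>\<^sup>2 * E \<xi>)) (at \<xi>)" for \<xi>
      unfolding V1_def
      by (rule DERIV_cong[OF DERIV_add[OF
            DERIV_mult[OF DERIV_mult[OF DERIV_cdivide[OF DERIV_minus[OF DERIV_ident]] E_deriv] M_deriv']
            DERIV_mult[OF DERIV_cdivide[OF M_deriv'] E_deriv]]]) (simp add: algebra_simps)
  qed
qed

subsection \<open>Inverse Gamma densities\<close>

lemma borel_measurable_ig_density [measurable]: "ig_density a b \<in> borel_measurable borel"
  unfolding ig_density_def by measurable

lemma Gamma_real_nonzero: "a > 0 \<Longrightarrow> Gamma (a :: real) \<noteq> 0"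
  by (metis Gamma_real_pos less_irrefl)

lemma ig_density_nonneg: "a > 0 \<Longrightarrow> b > 0 \<Longrightarrow> ig_density a b x \<ge> 0"
  by (auto simp: ig_density_def Gamma_real_pos less_imp_le)

lemma ig_density_pos: "a > 0 \<Longrightarrow> b > 0 \<Longrightarrow> x > 0 \<Longrightarrow> ig_density a b x > 0"
  by (auto simp: ig_density_def Gamma_real_pos)

lemma ig_density_nonpos: "x \<le> 0 \<Longrightarrow> ig_density a b x = 0"
  by (simp add: ig_density_def)

lemma ln_ig_density:
  assumes "a > 0" "b > 0" "x > 0"
  shows "ln (ig_density a b x) = a * ln b - ln (Gamma a) - (a + 1) * ln x - b / x"
  using assms by (simp add: ig_density_def Gamma_real_nonzero ln_mult ln_div ln_powr algebra_simps)

text \<open>The substitution \<open>t = b / x\<close> carries the Gamma integral to this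
  density.\<close>

lemma ig_density_integral:
  assumes a: "a > 0" and b: "b > 0"
  shows "has_bochner_integral lborel (ig_density a b) 1"
proof -
  define f where "f t = t powr (a - 1) / exp t" for t :: real
  have Gamma: "Gamma a > 0"
    using a by (rule Gamma_real_pos)
  \<comment> \<open>Division of \<open>b\<close> by \<open>x\<close> is a bijection of the open
    half-line, so the endpoint 0 is removed as a null set.\<close>
  have f_int: "(f has_integral Gamma a) {0<..}"
  proof -
    have "(f has_integral Gamma a) {0..}"
      unfolding f_def using Gamma_integral_real[OF a] .
    moreover have "negligible {x \<in> {0..} - {0<..}. f x \<noteq> 0}" "negligible {x \<in> {0<..} - {0..}. f x \<noteq> 0}"
      by (auto intro: negligible_subset[of "{0}"])
    ultimately show ?thesis
      using has_integral_spike_set_eq by blast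
  qed
  then have "f absolutely_integrable_on {0<..}"
    by (intro nonnegative_absolutely_integrable_1) (auto simp: f_def has_integral_integrable)
  moreover have "(\<lambda>x. b / x) ` {0<..} = {0<..}"
  proof (intro equalityI subsetI)
    fix t :: real assume "t \<in> {0<..}"
    then show "t \<in> (\<lambda>x. b / x) ` {0<..}"
      using b by (intro image_eqI[of _ _ "b / t"]) auto
  qed (use b in auto)
  moreover have "inj_on (\<lambda>x. b / x) {0<..}"
    using b by (auto simp: inj_on_def field_simps)
  moreover have "((\<lambda>x. b / x) has_field_derivative - (b / x\<^sup>2)) (at x within {0<..})" if "x \<in> {0<..}" for x
    using that by (auto intro!: derivative_eq_intros simp: power2_eq_square)
  ultimately have sub: "(\<lambda>x. \<bar>- (b / x\<^sup>2)\<bar> * f (b / x)) absolutely_integrable_on {0<..} \<and>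
      integral {0<..} (\<lambda>x. \<bar>- (b / x\<^sup>2)\<bar> * f (b / x)) = Gamma a"
    using f_int has_absolute_integral_change_of_variables_1'[of "{0<..}" "\<lambda>x. b / x" "\<lambda>x. - (b / x\<^sup>2)" f "Gamma a"]
    by (simp add: integral_unique)
  have eq: "indicator {0<..} x *\<^sub>R (\<bar>- (b / x\<^sup>2)\<bar> * f (b / x)) = Gamma a * ig_density a b x" for x
  proof (cases "x > 0")
    case True
    have "b / x\<^sup>2 * (b / x) powr (a - 1) = b powr a * x powr (- a - 1)"
      using True b by (simp add: powr_divide powr_diff powr_minus power2_eq_square field_simps)
    then show ?thesis
      using True b Gamma by (simp add: f_def ig_density_def exp_minus field_simps)
  qed (simp add: ig_density_def)
  \<comment> \<open>The substitution lives on the completed measure; for a Borel function,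
    integrability and integral agree with those for \<open>lborel\<close>.\<close>
  have "integrable lebesgue (\<lambda>x. Gamma a * ig_density a b x)"
    using sub unfolding set_integrable_def eq by blast
  then have int: "integrable lborel (\<lambda>x. Gamma a * ig_density a b x)"
    by (subst (asm) integrable_completion) auto
  have "(LINT x|lborel. Gamma a * ig_density a b x) = (LINT x|lebesgue. Gamma a * ig_density a b x)"
    by (rule integral_completion[symmetric]) auto
  also have "\<dots> = integral {0<..} (\<lambda>x. \<bar>- (b / x\<^sup>2)\<bar> * f (b / x))"
    using set_lebesgue_integral_eq_integral(2)[of "{0<..}" "\<lambda>x. \<bar>- (b / x\<^sup>2)\<bar> * f (b / x)"] sub
    unfolding set_lebesgue_integral_def eq by simp
  finally have "(LINT x|lborel. Gamma a * ig_density a b x) = Gamma a"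
    using sub by simp
  then show ?thesis
    using int Gamma by (simp add: has_bochner_integral_iff)
qed

text \<open>A power only shifts the shape, so moments reduce to normalisation. \<open>r\<close> may
  be negative as long as the new shape stays positive.\<close>

lemma ig_density_mult_powr:
  assumes "a > 0" "b > 0" "a + r > 0"
  shows "ig_density a b x * x powr (- r) = Gamma (a + r) / (Gamma a * b powr r) * ig_density (a + r) b x"
proof (cases "x > 0")
  case True
  have "x powr (- a - 1) * x powr (- r) = x powr (- (a + r) - 1)"
    by (simp add: algebra_simps flip: powr_add)
  then show ?thesis
    using assms True by (simp add: Gamma_real_nonzero ig_density_def powr_add[of b] field_simps)
qed (simp add: ig_density_def)

text \<open>The case \<open>r = 1\<close> of the power shift, with
  \<open>Gamma (a + 1) = a * Gamma a\<close>. This is the mean precision that enters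
  \<open>prior_precision\<close>.\<close>

lemma ig_density_inverse_moment:
  assumes a: "a > 0" and b: "b > 0"
  shows "has_bochner_integral lborel (\<lambda>x. ig_density a b x * (1 / x)) (a / b)"
proof -
  have "a \<notin> \<int>\<^sub>\<le>\<^sub>0"
    using a by (auto elim!: nonpos_Ints_cases)
  then have coeff: "Gamma (a + 1) / (Gamma a * b powr 1) = a / b"
    using a b by (simp add: Gamma_plus1 Gamma_real_nonzero)
  have "ig_density a b x * x powr (- 1) = a / b * ig_density (a + 1) b x" for x
    using ig_density_mult_powr[OF a b add_pos_pos[OF a zero_less_one], of x] unfolding coeff .
  \<comment> \<open>For \<open>x \<le> 0\<close> both sides vanish with the density.\<close>
  moreover have "ig_density a b x * (1 / x) = ig_density a b x * x powr (- 1)" for x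
    by (cases "x > 0") (simp_all add: ig_density_def powr_minus inverse_eq_divide)
  ultimately have "ig_density a b x * (1 / x) = a / b * ig_density (a + 1) b x" for x
    by (simp only:)
  then show ?thesis
    using has_bochner_integral_mult_right[OF ig_density_integral[of "a + 1" b], of "a / b"] a b by simp
qed

lemma ig_density_ln_integrable:
  assumes a: "a > 0" and b: "b > 0"
  shows "integrable lborel (\<lambda>x. ig_density a b x * ln x)"
proof (rule Bochner_Integration.integrable_bound)
  \<comment> \<open>For \<open>x > 0\<close>, \<open>\<bar>ln x\<bar>\<close> is at most
    \<open>(x powr d + x powr (- d)) / d\<close>. Taking half the shape leaves a positive shape
    \<open>a - d\<close> for the positive power.\<close>
  define d where "d = a / 2"
  have d: "d > 0" using a by (simp add: d_def)
  have int: "integrable lborel (\<lambda>x. ig_density a b x * x powr (- r))" if "a + r > 0" for r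
    unfolding ig_density_mult_powr[OF a b that]
    using ig_density_integral[OF that b] by (auto simp: has_bochner_integral_iff)
  show "integrable lborel (\<lambda>x. (ig_density a b x * x powr (- d) + ig_density a b x * x powr (- (- d))) / d)"
    by (intro integrable_divide Bochner_Integration.integrable_add int) (use a in \<open>auto simp: d_def\<close>)
  show "AE x in lborel. norm (ig_density a b x * ln x)
      \<le> norm ((ig_density a b x * x powr (- d) + ig_density a b x * x powr (- (- d))) / d)"
  proof (rule AE_I2)
    fix x :: real
    show "norm (ig_density a b x * ln x)
      \<le> norm ((ig_density a b x * x powr (- d) + ig_density a b x * x powr (- (- d))) / d)"
    proof (cases "x > 0")
      case True
      have "d * ln x \<le> x powr d" "- d * ln x \<le> x powr (- d)"
        using True ln_le_minus_one[of "x powr d"] ln_le_minus_one[of "x powr (- d)"] by (auto simp: ln_powr)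
      moreover have "x powr d > 0" "x powr (- d) > 0"
        using True by auto
      ultimately have "d * \<bar>ln x\<bar> \<le> x powr (- d) + x powr d"
        by (cases "ln x \<ge> 0"; simp only: abs_of_nonneg abs_of_neg not_le; linarith)
      then have "ig_density a b x * \<bar>ln x\<bar> \<le> ig_density a b x * ((x powr (- d) + x powr d) / d)"
        using d by (intro mult_left_mono ig_density_nonneg a b) (simp add: field_simps)
      then show ?thesis
        using ig_density_nonneg[OF a b, of x] d by (simp add: abs_mult distrib_left)
    qed (simp add: ig_density_def)
  qed
qed measurable

subsection \<open>Variational expectations and their derivatives\<close>

text \<open>The log joint density is a sum of terms that factorise over the independent parts of
  \<open>\<theta>\<close>, and Fubini turns each expectation into a product of integrals.\<close>

lemma has_bochner_integral_pair_PiM_prod: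
  fixes f :: "'a::euclidean_space \<Rightarrow> real" and g :: "'h \<Rightarrow> real \<Rightarrow> real"
  assumes J: "finite J" and f: "has_bochner_integral lborel f v"
    and g: "\<And>h. h \<in> J \<Longrightarrow> has_bochner_integral lborel (g h) (w h)"
  shows "has_bochner_integral (lborel \<Otimes>\<^sub>M Pi\<^sub>M J (\<lambda>_. lborel)) (\<lambda>(b, s). f b * (\<Prod>h\<in>J. g h (s h)))
    (v * (\<Prod>h\<in>J. w h))"
proof -
  interpret product_sigma_finite "\<lambda>_::'h. lborel :: real measure" ..
  interpret J: finite_product_sigma_finite "\<lambda>_::'h. lborel :: real measure" J
    by standard (rule J)
  interpret pair_sigma_finite "lborel :: 'a measure" "Pi\<^sub>M J (\<lambda>_. lborel :: real measure)" ..
  have int_g: "\<And>h. h \<in> J \<Longrightarrow> integrable lborel (g h)" "\<And>h. h \<in> J \<Longrightarrow> integral\<^sup>L lborel (g h) = w h"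
    using g by (auto simp: has_bochner_integral_iff)
  let ?G = "\<lambda>s. \<Prod>h\<in>J. g h (s h)"
  have G: "integrable (Pi\<^sub>M J (\<lambda>_. lborel)) ?G" "integral\<^sup>L (Pi\<^sub>M J (\<lambda>_. lborel)) ?G = (\<Prod>h\<in>J. w h)"
    using product_integrable_prod[OF J int_g(1)] product_integral_prod[OF J int_g(1)] int_g(2) by simp_all
  have fint: "integrable lborel f" "integral\<^sup>L lborel f = v"
    using f by (auto simp: has_bochner_integral_iff)
  have [measurable]: "f \<in> borel_measurable borel" "?G \<in> borel_measurable (Pi\<^sub>M J (\<lambda>_. lborel))"
    using borel_measurable_integrable[OF fint(1)] borel_measurable_integrable[OF G(1)] by simp_all
  have int: "integrable (lborel \<Otimes>\<^sub>M Pi\<^sub>M J (\<lambda>_. lborel)) (\<lambda>(b, s). f b * ?G s)"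
  proof (rule Fubini_integrable)
    have "(\<lambda>x. f (fst x) * ?G (snd x)) \<in> borel_measurable (lborel \<Otimes>\<^sub>M Pi\<^sub>M J (\<lambda>_. lborel))"
      by measurable
    then show "(\<lambda>(b, s). f b * ?G s) \<in> borel_measurable (lborel \<Otimes>\<^sub>M Pi\<^sub>M J (\<lambda>_. lborel))"
      by (simp add: case_prod_beta')
    show "integrable lborel (\<lambda>x. \<integral>y. norm (case (x, y) of (b, s) \<Rightarrow> f b * ?G s) \<partial>Pi\<^sub>M J (\<lambda>_. lborel))"
      using fint(1) by (simp add: abs_mult)
    show "AE x in lborel. integrable (Pi\<^sub>M J (\<lambda>_. lborel)) (\<lambda>y. case (x, y) of (b, s) \<Rightarrow> f b * ?G s)"
      using G(1) by simp
  qed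
  moreover have "integral\<^sup>L (lborel \<Otimes>\<^sub>M Pi\<^sub>M J (\<lambda>_. lborel)) (\<lambda>(b, s). f b * ?G s) = v * (\<Prod>h\<in>J. w h)"
    using integral_fst'[OF int, symmetric] by (simp add: G(2) fint(2))
  ultimately show ?thesis
    by (simp add: has_bochner_integral_iff)
qed

text \<open>\<open>q_expectation\<close> returns 0 on functions that are not integrable against the
  density, so linearity needs integrability at every step; this relation carries both.\<close>

definition has_q_expectation ::
  "'h set \<Rightarrow> real^'k::finite \<Rightarrow> real^'k^'k \<Rightarrow> ('h \<Rightarrow> real) \<Rightarrow> ('h \<Rightarrow> real)
     \<Rightarrow> ((real^'k) \<times> ('h \<Rightarrow> real) \<Rightarrow> real) \<Rightarrow> real \<Rightarrow> bool" where
  "has_q_expectation J mu S al be F v \<longleftrightarrow>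
     has_bochner_integral (lborel \<Otimes>\<^sub>M Pi\<^sub>M J (\<lambda>_. lborel)) (\<lambda>\<theta>. q_density J mu S al be \<theta> * F \<theta>) v"

lemma has_q_expectation_eq: "has_q_expectation J mu S al be F v \<Longrightarrow> q_expectation J mu S al be F = v"
  unfolding has_q_expectation_def q_expectation_def by (rule has_bochner_integral_integral_eq)

text \<open>\<open>q_density\<close> vanishes as soon as some \<open>s h\<close> with
  \<open>h\<close> in \<open>J\<close> is not positive, and the expansions of \<open>ln\<close> are
  available only for positive arguments.\<close>

lemma has_q_expectation_cong:
  assumes "\<And>b s. (\<And>h. h \<in> J \<Longrightarrow> s h > 0) \<Longrightarrow> F (b, s) = F' (b, s)" and "finite J"
  shows "has_q_expectation J mu S al be F v \<longleftrightarrow> has_q_expectation J mu S al be F' v"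
proof -
  have "q_density J mu S al be \<theta> * F \<theta> = q_density J mu S al be \<theta> * F' \<theta>" for \<theta>
  proof (cases \<theta>)
    case (Pair b s)
    show ?thesis
    proof (cases "\<forall>h\<in>J. s h > 0")
      case False
      then have "(\<Prod>h\<in>J. ig_density (al h) (be h) (s h)) = 0"
        using \<open>finite J\<close> by (auto simp: prod_zero_iff ig_density_def)
      then show ?thesis
        by (simp add: Pair q_density_def)
    qed (use assms in \<open>auto simp: Pair\<close>)
  qed
  then show ?thesis
    unfolding has_q_expectation_def by (simp only:)
qed

lemma has_q_expectation_add:
  "has_q_expectation J mu S al be F v \<Longrightarrow> has_q_expectation J mu S al be G w
    \<Longrightarrow> has_q_expectation J mu S al be (\<lambda>\<theta>. F \<theta> + G \<theta>) (v + w)"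
  unfolding has_q_expectation_def distrib_left by (rule has_bochner_integral_add)

lemma has_q_expectation_diff:
  "has_q_expectation J mu S al be F v \<Longrightarrow> has_q_expectation J mu S al be G w
    \<Longrightarrow> has_q_expectation J mu S al be (\<lambda>\<theta>. F \<theta> - G \<theta>) (v - w)"
  unfolding has_q_expectation_def right_diff_distrib by (rule has_bochner_integral_diff)

lemma has_q_expectation_cmult:
  "has_q_expectation J mu S al be F v \<Longrightarrow> has_q_expectation J mu S al be (\<lambda>\<theta>. c * F \<theta>) (c * v)"
  unfolding has_q_expectation_def mult.left_commute[of _ c]
  by (rule has_bochner_integral_mult_right)

lemma has_q_expectation_sum:
  "(\<And>i. i \<in> I \<Longrightarrow> has_q_expectation J mu S al be (F i) (v i))
    \<Longrightarrow> has_q_expectation J mu S al be (\<lambda>\<theta>. \<Sum>i\<in>I. F i \<theta>) (\<Sum>i\<in>I. v i)"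
  unfolding has_q_expectation_def sum_distrib_left by (rule has_bochner_integral_sum)

lemma has_q_expectation_gaussian_factor:
  assumes J: "finite J" and ig: "\<And>h. al h > 0" "\<And>h. be h > 0"
    and f: "has_bochner_integral lborel (\<lambda>b. mvn_density mu S b * f b) v"
  shows "has_q_expectation J mu S al be (\<lambda>(b, s). f b) v"
  unfolding has_q_expectation_def
  using has_bochner_integral_pair_PiM_prod[OF J f ig_density_integral[OF ig]]
  by (simp add: q_density_def case_prod_beta' mult_ac)

lemma has_q_expectation_mixed_factor:
  assumes J: "finite J" "k \<in> J" and ig: "\<And>h. al h > 0" "\<And>h. be h > 0"
    and f: "has_bochner_integral lborel (\<lambda>b. mvn_density mu S b * f b) v"
    and g: "has_bochner_integral lborel (\<lambda>x. ig_density (al k) (be k) x * g x) w"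
  shows "has_q_expectation J mu S al be (\<lambda>(b, s). f b * g (s k)) (v * w)"
proof -
  \<comment> \<open>\<open>g\<close> is merged into the \<open>k\<close>-th factor so that the
    product rule applies; the other inverse Gamma factors integrate to 1.\<close>
  define G where "G h x = (if h = k then ig_density (al k) (be k) x * g x else ig_density (al h) (be h) x)" for h x
  have "has_bochner_integral lborel (G h) (if h = k then w else 1)" for h
    using g ig_density_integral[OF ig, of h] by (auto simp: G_def[abs_def])
  from has_bochner_integral_pair_PiM_prod[OF J(1) f, of G "\<lambda>h. if h = k then w else 1", OF this]
  have "has_bochner_integral (lborel \<Otimes>\<^sub>M Pi\<^sub>M J (\<lambda>_. lborel))
      (\<lambda>(b, s). mvn_density mu S b * f b * (\<Prod>h\<in>J. G h (s h))) (v * w)"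
    using J by simp
  moreover have "(\<Prod>h\<in>J. G h (s h)) = (\<Prod>h\<in>J. ig_density (al h) (be h) (s h)) * g (s k)" for s
  proof -
    have "(\<Prod>h\<in>J - {k}. G h (s h)) = (\<Prod>h\<in>J - {k}. ig_density (al h) (be h) (s h))"
      by (rule prod.cong) (auto simp: G_def)
    then show ?thesis
      by (simp add: prod.remove[OF J] G_def)
  qed
  ultimately show ?thesis
    unfolding has_q_expectation_def by (simp add: q_density_def case_prod_beta' mult_ac)
qed

text \<open>The updates ask for some pair \<open>g\<close>, \<open>H\<close>; uniqueness turns that
  into equations. Two gradient fields agree in a neighbourhood of \<open>x\<close>, which is enough
  for equal derivatives at \<open>x\<close>.\<close>

lemma has_grad_hess_unique:
  fixes F :: "real^'k \<Rightarrow> real"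
  assumes "has_grad_hess F x g H" "has_grad_hess F x g' H'"
  shows "g = g' \<and> H = H'"
proof -
  obtain G where G: "\<forall>\<^sub>F m in nhds x. GDERIV F m :> G m" "G x = g" "(G has_derivative (\<lambda>v. H *v v)) (at x)"
    using assms(1) unfolding has_grad_hess_def by blast
  obtain G' where G': "\<forall>\<^sub>F m in nhds x. GDERIV F m :> G' m" "G' x = g'" "(G' has_derivative (\<lambda>v. H' *v v)) (at x)"
    using assms(2) unfolding has_grad_hess_def by blast
  have eq: "\<forall>\<^sub>F m in nhds x. G' m = G m"
    using G(1) G'(1)
  proof eventually_elim
    case (elim m)
    then have "(\<lambda>h. h \<bullet> G m) = (\<lambda>h. h \<bullet> G' m)"
      unfolding gderiv_def by (rule has_derivative_unique)
    then have "h \<bullet> G m = h \<bullet> G' m" for h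
      by (rule fun_cong)
    then show ?case
      by (metis vector_eq_ldot)
  qed
  then have "G' x = G x"
    by (rule eventually_nhds_x_imp_x)
  moreover have "(G has_derivative (\<lambda>v. H' *v v)) (at x)"
    by (rule has_derivative_transform_eventually[OF G'(3)])
       (use eq \<open>G' x = G x\<close> in \<open>auto simp: eventually_at_filter elim: eventually_mono\<close>)
  then have "(\<lambda>v. H *v v) = (\<lambda>v. H' *v v)"
    by (rule has_derivative_unique[OF G(3)])
  then have "H = H'"
    by (simp add: fun_eq_iff matrix_eq)
  ultimately show ?thesis
    using G(2) G'(2) by simp
qed

lemma transpose_mult_eq_sum:
  fixes M :: "real^'k^'n"
  shows "transpose M *v w = (\<Sum>i\<in>UNIV. w $ i *\<^sub>R M $ i)"
  by (simp add: vec_eq_iff transpose_def matrix_vector_mult_def mult.commute)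

lemma diag_mat_mult: "diag_mat w *v x = (\<chi> i. w $ i * x $ i)"
  by (simp add: diag_mat_def vec_eq_iff matrix_vector_mult_def if_distrib[of "\<lambda>a. a * _"] cong: if_cong)

text \<open>Each \<open>V i (M $ i \<bullet> m)\<close> is a ridge function: by the chain rule it
  contributes \<open>V1\<close> times the row to the gradient and \<open>V2\<close> times the outer
  square of the row to the Hessian. At a zero row it is constant in \<open>m\<close>, whatever the
  regularity of \<open>V i\<close>.\<close>

lemma has_grad_hess_ridge_sum:
  fixes M :: "real^'k^'n" and R :: "real^'k^'k" and V V1 V2 :: "'n \<Rightarrow> real \<Rightarrow> real"
  assumes F: "\<And>m. F m = c - (\<Sum>i\<in>UNIV. V i (M $ i \<bullet> m)) - (1/2) * (m \<bullet> (R *v m))"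
    and R: "transpose R = R"
    and V: "\<And>i \<xi>. M $ i \<noteq> 0 \<Longrightarrow> (V i has_real_derivative V1 i \<xi>) (at \<xi>)"
      "\<And>i \<xi>. M $ i \<noteq> 0 \<Longrightarrow> (V1 i has_real_derivative V2 i \<xi>) (at \<xi>)"
    and w: "\<And>i. M $ i \<noteq> 0 \<Longrightarrow> w1 $ i = V1 i (M $ i \<bullet> x)" "\<And>i. M $ i \<noteq> 0 \<Longrightarrow> w2 $ i = V2 i (M $ i \<bullet> x)"
  shows "has_grad_hess F x (- (transpose M *v w1) - R *v x) (- (R + transpose M ** diag_mat w2 ** M))"
proof -
  define G where "G m = - (\<Sum>i\<in>UNIV. V1 i (M $ i \<bullet> m) *\<^sub>R M $ i) - R *v m" for m
  have lin: "((\<lambda>m. R *v m) has_derivative (\<lambda>v. R *v v)) (at m)" for m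
    by (rule linear_imp_has_derivative) simp
  have dV: "((\<lambda>m. V i (M $ i \<bullet> m)) has_derivative (\<lambda>v. v \<bullet> (V1 i (M $ i \<bullet> m) *\<^sub>R M $ i))) (at m)" for i m
  proof (cases "M $ i = 0")
    case False
    have "((\<lambda>m. M $ i \<bullet> m) has_derivative (\<lambda>v. M $ i \<bullet> v)) (at m)"
      by (intro derivative_eq_intros) auto
    from has_derivative_compose[OF this V(1)[OF False, unfolded has_field_derivative_def]]
    show ?thesis by (simp add: inner_commute)
  qed simp
  have "GDERIV F m :> G m" for m
  proof -
    have "(F has_derivative (\<lambda>v. 0 - (\<Sum>i\<in>UNIV. v \<bullet> (V1 i (M $ i \<bullet> m) *\<^sub>R M $ i))
        - (1/2) * (m \<bullet> (R *v v) + v \<bullet> (R *v m)))) (at m)"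
      unfolding F[abs_def]
      by (intro has_derivative_diff has_derivative_const has_derivative_sum dV has_derivative_mult_right
          has_derivative_inner has_derivative_ident lin)
    moreover have "0 - (\<Sum>i\<in>UNIV. v \<bullet> (V1 i (M $ i \<bullet> m) *\<^sub>R M $ i))
        - (1/2) * (m \<bullet> (R *v v) + v \<bullet> (R *v m)) = v \<bullet> G m" for v
      by (simp add: inner_symmetric_matrix[OF R, of m v] G_def inner_diff_right inner_sum_right)
    ultimately show ?thesis
      by (simp add: gderiv_def)
  qed
  moreover have "G x = - (transpose M *v w1) - R *v x"
  proof -
    have "V1 i (M $ i \<bullet> x) *\<^sub>R M $ i = w1 $ i *\<^sub>R M $ i" for i
      using w(1)[of i] by (cases "M $ i = 0") auto
    then show ?thesis
      by (simp only: G_def transpose_mult_eq_sum)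
  qed
  moreover have "(G has_derivative (\<lambda>v. - (R + transpose M ** diag_mat w2 ** M) *v v)) (at x)"
  proof -
    have "((\<lambda>m. V1 i (M $ i \<bullet> m) *\<^sub>R M $ i) has_derivative (\<lambda>v. (w2 $ i * (M $ i \<bullet> v)) *\<^sub>R M $ i)) (at x)" for i
    proof (cases "M $ i = 0")
      case False
      have "((\<lambda>m. M $ i \<bullet> m) has_derivative (\<lambda>v. M $ i \<bullet> v)) (at x)"
        by (intro derivative_eq_intros) auto
      from has_derivative_compose[OF this V(2)[OF False, unfolded has_field_derivative_def]]
      have "((\<lambda>m. V1 i (M $ i \<bullet> m)) has_derivative (\<lambda>v. w2 $ i * (M $ i \<bullet> v))) (at x)"
        by (simp add: w(2)[OF False])
      then show ?thesis
        by (rule has_derivative_scaleR_left)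
    qed simp
    then have "(G has_derivative (\<lambda>v. - (\<Sum>i\<in>UNIV. (w2 $ i * (M $ i \<bullet> v)) *\<^sub>R M $ i) - R *v v)) (at x)"
      unfolding G_def[abs_def] by (intro has_derivative_diff has_derivative_minus has_derivative_sum lin)
    moreover have "- (\<Sum>i\<in>UNIV. (w2 $ i * (M $ i \<bullet> v)) *\<^sub>R M $ i) - R *v v
        = - (R + transpose M ** diag_mat w2 ** M) *v v" for v
    proof -
      have "(transpose M ** diag_mat w2 ** M) *v v = transpose M *v (diag_mat w2 *v (M *v v))"
        by (simp only: matrix_vector_mul_assoc matrix_mul_assoc)
      also have "\<dots> = (\<Sum>i\<in>UNIV. (w2 $ i * (M $ i \<bullet> v)) *\<^sub>R M $ i)"
        by (simp only: diag_mat_mult transpose_mult_eq_sum vec_lambda_beta matrix_vector_mul_component)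
      moreover have "- (R + transpose M ** diag_mat w2 ** M) *v v
          = - (R *v v + (transpose M ** diag_mat w2 ** M) *v v)"
        by (simp add: vec_eq_iff matrix_vector_mult_def sum.distrib sum_negf left_diff_distrib sum_subtractf distrib_right)
      ultimately show ?thesis by simp
    qed
    ultimately show ?thesis by simp
  qed
  ultimately show ?thesis
    unfolding has_grad_hess_def by (intro exI[of _ G]) simp
qed

subsection \<open>The generalized linear mixed model\<close>

lemma sum_UNIV_Plus:
  fixes f :: "'a::finite + 'b::finite \<Rightarrow> 'c::comm_monoid_add"
  shows "(\<Sum>i\<in>UNIV. f i) = (\<Sum>a\<in>UNIV. f (Inl a)) + (\<Sum>b\<in>UNIV. f (Inr b))"
  using sum.Plus[of "UNIV :: 'a set" "UNIV :: 'b set" f] by simp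

text \<open>Padding with zeros makes quadratic forms of sub-vectors into forms in the whole Gaussian
  vector, so their expectations come from \<open>mvn_quadratic_form\<close> without passing to
  marginal laws.\<close>

definition beta_mat :: "real^'p::finite^'p \<Rightarrow> real^('p + 'd::finite)^('p + 'd)" where
  "beta_mat M = (\<chi> i j. case (i, j) of (Inl a, Inl b) \<Rightarrow> M $ a $ b | _ \<Rightarrow> 0)"

definition u_mat :: "real^'d::finite^'d \<Rightarrow> real^('p::finite + 'd)^('p + 'd)" where
  "u_mat M = (\<chi> i j. case (i, j) of (Inr a, Inr b) \<Rightarrow> M $ a $ b | _ \<Rightarrow> 0)"

lemma beta_mat_nth [simp]:
  "beta_mat M $ Inl a $ Inl b = M $ a $ b"
  "beta_mat M $ Inr c $ j = 0" "beta_mat M $ i $ Inr c = 0"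
  by (simp_all add: beta_mat_def split: sum.split)

lemma u_mat_nth [simp]:
  "u_mat M $ Inr a $ Inr b = M $ a $ b"
  "u_mat M $ Inl c $ j = 0" "u_mat M $ i $ Inl c = 0"
  by (simp_all add: u_mat_def split: sum.split)

lemma beta_mat_quadratic: "b \<bullet> (beta_mat M *v b) = beta_part b \<bullet> (M *v beta_part b)"
  by (simp add: inner_matrix_eq_sum sum_UNIV_Plus beta_part_def)

lemma u_mat_quadratic: "b \<bullet> (u_mat M *v b) = u_part b \<bullet> (M *v u_part b)"
  by (simp add: inner_matrix_eq_sum sum_UNIV_Plus u_part_def)

lemma block_mat_zero:
  assumes "block_mat blk h M = M" "\<not> (blk i = h \<and> blk j = h)"
  shows "M $ i $ j = 0"
proof -
  have "block_mat blk h M $ i $ j = 0"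
    using assms(2) by (auto simp: block_mat_def)
  then show ?thesis
    by (simp only: assms(1))
qed

lemma block_mat_quadratic:
  assumes "block_mat blk h M = M"
  shows "block_vec blk h v \<bullet> (M *v block_vec blk h v) = v \<bullet> (M *v v)"
proof -
  have "M $ i $ j * (block_vec blk h v $ i * block_vec blk h v $ j) = M $ i $ j * (v $ i * v $ j)" for i j
    using block_mat_zero[OF assms, of i j] by (cases "blk i = h \<and> blk j = h") (auto simp: block_vec_def)
  then show ?thesis
    by (simp only: inner_matrix_eq_sum)
qed

lemma transpose_eq_nth:
  assumes "transpose M = M"
  shows "M $ i $ j = M $ j $ i"
proof -
  have "transpose M $ i $ j = M $ j $ i"
    by (simp add: transpose_def)
  then show ?thesis
    by (simp only: assms)
qed

text \<open>Restricting \<open>S\<close> to block \<open>h\<close> changes nothing, as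
  \<open>M\<close> is zero elsewhere; symmetry of \<open>S\<close> exchanges the indices in the
  trace.\<close>

lemma trace_block_mat:
  fixes S :: "real^('p::finite + 'd::finite)^('p + 'd)"
  assumes "block_mat blk h M = M" "transpose S = S"
  shows "trace (M ** block_mat blk h (uu_part S)) = (\<Sum>i\<in>UNIV. \<Sum>j\<in>UNIV. u_mat M $ i $ j * S $ i $ j)"
proof -
  have "S $ Inr j $ Inr i = S $ Inr i $ Inr j" for i j
    by (rule transpose_eq_nth[OF assms(2)])
  then have eq: "M $ i $ j * block_mat blk h (uu_part S) $ j $ i = M $ i $ j * S $ Inr i $ Inr j" for i j
    using block_mat_zero[OF assms(1), of i j]
    by (cases "blk i = h \<and> blk j = h") (auto simp: block_mat_def uu_part_def)
  have "trace (M ** block_mat blk h (uu_part S))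
      = (\<Sum>i\<in>UNIV. \<Sum>j\<in>UNIV. M $ i $ j * block_mat blk h (uu_part S) $ j $ i)"
    by (simp add: trace_def matrix_matrix_mult_def)
  also have "\<dots> = (\<Sum>i\<in>UNIV. \<Sum>j\<in>UNIV. M $ i $ j * S $ Inr i $ Inr j)"
    by (simp only: eq)
  finally show ?thesis
    by (simp add: sum_UNIV_Plus)
qed

text \<open>Each coordinate of \<open>u\<close> lies in exactly one block, so the sum over blocks
  collapses.\<close>

lemma lin_pred_eq_inner: "lin_pred blk X Z b i = design_mat X Z $ i \<bullet> b"
proof -
  have "(\<Sum>h\<in>UNIV. block_vec blk h (Z $ i) \<bullet> block_vec blk h (u_part b))
      = (\<Sum>j\<in>UNIV. \<Sum>h\<in>UNIV. if h = blk j then Z $ i $ j * u_part b $ j else 0)"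
    unfolding inner_vec_def
    by (subst sum.swap) (auto simp: block_vec_def intro!: sum.cong)
  also have "\<dots> = Z $ i \<bullet> u_part b"
    by (simp add: inner_vec_def)
  finally show ?thesis
    by (simp add: lin_pred_def inner_vec_def sum_UNIV_Plus design_mat_def beta_part_def u_part_def)
qed

lemma prior_precision_quadratic:
  assumes "\<And>h. block_mat blk h (R h) = R h"
  shows "m \<bullet> (prior_precision blk sb2 Rb R al be *v m)
    = m \<bullet> (beta_mat Rb *v m) / sb2 + (\<Sum>h\<in>UNIV. al h / be h * (m \<bullet> (u_mat (R h) *v m)))"
proof -
  let ?P = "prior_precision blk sb2 Rb R al be"
  \<comment> \<open>\<open>R h\<close> vanishes outside its own block, so only the term
    \<open>h = blk i\<close> can survive, and it does so only when \<open>blk j\<close> is the same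
    block.\<close>
  have RR: "?P $ Inr i $ Inr j = (\<Sum>h\<in>UNIV. al h / be h * R h $ i $ j)" for i j
  proof -
    have "(\<Sum>h\<in>UNIV. al h / be h * R h $ i $ j)
        = (\<Sum>h\<in>UNIV. if h = blk i then (if blk i = blk j then al (blk i) / be (blk i) * R (blk i) $ i $ j else 0) else 0)"
      using block_mat_zero[OF assms, of i _ j] by (intro sum.cong) auto
    then show ?thesis by (simp add: prior_precision_def)
  qed
  have other: "?P $ Inl c $ Inl c' = Rb $ c $ c' / sb2" "?P $ Inl c $ Inr j = 0" "?P $ Inr i $ Inl c = 0" for c c' i j
    by (simp_all add: prior_precision_def)
  have "(\<Sum>h\<in>UNIV. al h / be h * (m \<bullet> (u_mat (R h) *v m)))
      = (\<Sum>i\<in>UNIV. \<Sum>j\<in>UNIV. (\<Sum>h\<in>UNIV. al h / be h * R h $ i $ j) * (m $ Inr i * m $ Inr j))"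
  proof -
    have "(\<Sum>h\<in>UNIV. al h / be h * (m \<bullet> (u_mat (R h) *v m)))
        = (\<Sum>h\<in>UNIV. \<Sum>i\<in>UNIV. \<Sum>j\<in>UNIV. al h / be h * R h $ i $ j * (m $ Inr i * m $ Inr j))"
      by (simp add: inner_matrix_eq_sum sum_UNIV_Plus sum_distrib_left mult.assoc)
    also have "\<dots> = (\<Sum>i\<in>UNIV. \<Sum>h\<in>UNIV. \<Sum>j\<in>UNIV. al h / be h * R h $ i $ j * (m $ Inr i * m $ Inr j))"
      by (rule sum.swap)
    also have "\<dots> = (\<Sum>i\<in>UNIV. \<Sum>j\<in>UNIV. \<Sum>h\<in>UNIV. al h / be h * R h $ i $ j * (m $ Inr i * m $ Inr j))"
      by (intro sum.cong refl) (rule sum.swap)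
    finally show ?thesis
      by (simp only: sum_distrib_right)
  qed
  then show ?thesis
    by (simp add: inner_matrix_eq_sum[of m ?P] inner_matrix_eq_sum[of m "beta_mat Rb"] sum_UNIV_Plus
        RR other sum_divide_distrib)
qed

lemma transpose_prior_precision:
  assumes "transpose Rb = Rb" "\<And>h. transpose (R h) = R h"
  shows "transpose (prior_precision blk sb2 Rb R al be) = prior_precision blk sb2 Rb R al be"
proof -
  have "Rb $ j $ i = Rb $ i $ j" "R h $ b $ a = R h $ a $ b" for i j h a b
    by (rule transpose_eq_nth[OF assms(1)], rule transpose_eq_nth[OF assms(2)])
  then show ?thesis
    by (auto simp: vec_eq_iff transpose_def prior_precision_def split: sum.splits)
qed

text \<open>\<open>sqrt\<close> is negative on negative reals, so the sign of \<open>det S\<close>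
  matters; a factorisation adapted to any nonzero vector shows that it is a square.\<close>

lemma mvn_density_nonneg:
  assumes "sym_pd S"
  shows "mvn_density mu S b \<ge> 0"
proof -
  have "(axis undefined 1 :: real^'a) \<noteq> 0"
    by (simp add: axis_eq_0_iff)
  from sym_pd_factorization[OF assms this] obtain L :: "real^'a^'a" where "S = L ** transpose L"
    by metis
  then have "det S = (det L)\<^sup>2"
    by (simp add: det_mul power2_eq_square)
  then show ?thesis
    by (simp add: mvn_density_def)
qed

text \<open>The left factors are the Gaussian prior kernel of one block as a function of its
  variance, with \<open>r\<close> half the block size and \<open>q\<close> half the quadratic form.
  The constant is the quotient of the two normalisations.\<close>

lemma ig_density_conjugate:
  assumes "a > 0" "b > 0" "r \<ge> 0" "q \<ge> 0"
  shows "x powr (- r) * exp (- q / x) * ig_density a b x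
    = b powr a * Gamma (a + r) / (Gamma a * (b + q) powr (a + r)) * ig_density (a + r) (b + q) x"
proof (cases "x > 0")
  case True
  have "x powr (- r) * x powr (- a - 1) = x powr (- (a + r) - 1)"
    by (simp add: algebra_simps flip: powr_add)
  moreover have "exp (- q / x) * exp (- b / x) = exp (- (b + q) / x)"
    by (simp add: diff_divide_distrib flip: exp_add)
  moreover have "x powr (- r) * exp (- q / x) * ig_density a b x
      = b powr a / Gamma a * (x powr (- r) * x powr (- a - 1)) * (exp (- q / x) * exp (- b / x))"
    using True by (simp add: ig_density_def)
  ultimately have "x powr (- r) * exp (- q / x) * ig_density a b x
      = b powr a / Gamma a * x powr (- (a + r) - 1) * exp (- (b + q) / x)"
    by (simp only:)
  also have "\<dots> = b powr a * Gamma (a + r) / (Gamma a * (b + q) powr (a + r)) * ig_density (a + r) (b + q) x"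
    using assms True by (simp add: ig_density_def Gamma_real_nonzero)
  finally show ?thesis .
qed (simp add: ig_density_def)

text \<open>\<open>S\<close>, \<open>al\<close> and \<open>be\<close> are fixed while the mean is
  left free, because the objective is differentiated in the mean alone. \<open>K\<close> is the
  unspecified constant of \<open>joint\<close>: it is additive in the objective and cancels in the
  full conditional.\<close>

locale glmm =
  fixes psi :: "'y::topological_space \<Rightarrow> real \<Rightarrow> real"
    and y :: "'n::finite \<Rightarrow> 'y"
    and blk :: "'d::finite \<Rightarrow> 'h::finite"
    and X :: "real^'p::finite^'n" and Z :: "real^'d^'n" and C :: "real^('p + 'd)^'n"
    and sb2 :: real and Rb :: "real^'p^'p" and R :: "'h \<Rightarrow> real^'d^'d"
    and A B :: "'h \<Rightarrow> real"
    and joint :: "(real^('p + 'd)) \<times> ('h \<Rightarrow> real) \<Rightarrow> real" and K :: real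
    and S :: "real^('p + 'd)^('p + 'd)" and al be :: "'h \<Rightarrow> real"
  assumes psi_measurable [measurable]: "\<And>v. psi v \<in> borel_measurable borel"
    and psi_integrable: "\<And>v m \<tau>. \<tau> > 0 \<Longrightarrow> integrable lborel (\<lambda>e. normal_density m \<tau> e * psi v e)"
    and Rb: "sym_psd Rb"
    and R: "\<And>h. sym_psd (R h)" "\<And>h. block_mat blk h (R h) = R h"
    and hyper: "sb2 > 0" "\<And>h. A h > 0" "\<And>h. B h > 0"
    and K: "K > 0" and joint: "\<And>\<theta>. joint \<theta> = K * joint_kernel psi y blk X Z sb2 Rb R A B \<theta>"
    and S: "sym_pd S" and ig: "\<And>h. al h > 0" "\<And>h. be h > 0"
    and C_def: "C = design_mat X Z"
begin

abbreviation "Qb b \<equiv> b \<bullet> (beta_mat Rb *v b)"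
abbreviation "Q h b \<equiv> b \<bullet> (u_mat (R h) *v b)"
abbreviation "nu i \<equiv> sqrt (C $ i \<bullet> (S *v C $ i))"
abbreviation "V i \<xi> \<equiv> LINT z|lborel. psi (y i) (\<xi> + nu i * z) * std_normal_density z"
abbreviation "Rbar \<equiv> prior_precision blk sb2 Rb R al be"
abbreviation "Qtr h \<equiv> trace (R h ** block_mat blk h (uu_part S))"

lemmas q_gaussian = has_q_expectation_gaussian_factor[where al=al and be=be, OF _ ig]
lemmas q_mixed = has_q_expectation_mixed_factor[where al=al and be=be, OF _ _ ig]

lemma S_sym: "transpose S = S"
  using S by (simp add: sym_pd_def)

lemma Q_eq: "block_vec blk h (u_part b) \<bullet> (R h *v block_vec blk h (u_part b)) = Q h b"
  using block_mat_quadratic[OF R(2)] by (simp add: u_mat_quadratic)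

lemma Q_nonneg: "Q h b \<ge> 0"
  using R(1)[of h] unfolding Q_eq[symmetric] sym_psd_def by blast

lemma joint_eq:
  "joint (b, s) = K * (\<Prod>i\<in>UNIV. exp (- psi (y i) (C $ i \<bullet> b))) * exp (- Qb b / (2 * sb2))
     * (\<Prod>h\<in>UNIV. s h powr (- real (block_dim blk h) / 2) * exp (- Q h b / (2 * s h)) * ig_density (A h) (B h) (s h))"
  by (simp add: joint joint_kernel_def lin_pred_eq_inner C_def Q_eq beta_mat_quadratic mult.assoc)

lemma nu_pos: "C $ i \<noteq> 0 \<Longrightarrow> nu i > 0"
  using S by (simp add: sym_pd_def)

section \<open>Expected log joint density and its derivatives in the mean\<close>

lemma psi_expectation:
  "has_bochner_integral lborel (\<lambda>b. mvn_density m S b * psi (y i) (C $ i \<bullet> b)) (V i (C $ i \<bullet> m))"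
proof (rule mvn_linear_functional[OF S psi_measurable])
  have "integrable lborel (\<lambda>z. psi (y i) (C $ i \<bullet> m + nu i * z) * std_normal_density z)"
  proof (cases "C $ i = 0")
    \<comment> \<open>Here \<open>nu i = 0\<close>, so the integrand is a constant times
      \<open>std_normal_density\<close>; the integrability assumption on the loss speaks of positive
      variances only.\<close>
    case True
    then show ?thesis by simp
  next
    case False
    note pos = nu_pos[OF False]
    have "integrable lborel (\<lambda>z. nu i * (normal_density (C $ i \<bullet> m) (nu i) (C $ i \<bullet> m + nu i * z)
        * psi (y i) (C $ i \<bullet> m + nu i * z)))"
      using lborel_integrable_real_affine[OF psi_integrable[OF pos, of "C $ i \<bullet> m" "y i"], of "nu i" "C $ i \<bullet> m"] pos
      by (intro integrable_mult_right) simp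
    moreover have "nu i * (normal_density (C $ i \<bullet> m) (nu i) (C $ i \<bullet> m + nu i * z) * w)
        = w * std_normal_density z" for w z
    proof -
      have "t * (normal_density a t (a + t * z) * w) = w * std_normal_density z" if "t > 0" for a t
        using that by (simp add: normal_density_def power_mult_distrib real_sqrt_mult)
      then show ?thesis using pos .
    qed
    ultimately show ?thesis by simp
  qed
  then show "has_bochner_integral lborel
      (\<lambda>z. std_normal_density z * psi (y i) (C $ i \<bullet> m + nu i * z)) (V i (C $ i \<bullet> m))"
    by (simp add: has_bochner_integral_iff mult.commute)
qed

lemma Q_expectation:
  "has_bochner_integral lborel (\<lambda>b. mvn_density m S b * Q h b) (Q h m + Qtr h)"
  using mvn_quadratic_form[OF S, of m "u_mat (R h)"] by (simp add: trace_block_mat[OF R(2) S_sym])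

text \<open>Each summand is arranged as a function of \<open>b\<close> times a function of at most
  one \<open>s h\<close>, the shape whose expectation factorises.\<close>

lemma ln_joint:
  assumes s: "\<And>h. s h > 0"
  shows "ln (joint (b, s)) = ln K + (\<Sum>h\<in>UNIV. A h * ln (B h) - ln (Gamma (A h)))
    - (\<Sum>i\<in>UNIV. psi (y i) (C $ i \<bullet> b)) - 1 / (2 * sb2) * Qb b
    - (\<Sum>h\<in>UNIV. (real (block_dim blk h) / 2 + A h + 1) * ln (s h) + 1/2 * (Q h b * (1 / s h)) + B h * (1 / s h))"
proof -
  let ?f = "\<lambda>h. s h powr (- real (block_dim blk h) / 2) * exp (- Q h b / (2 * s h)) * ig_density (A h) (B h) (s h)"
  have pos: "?f h > 0" for h
    using s[of h] ig_density_pos[OF hyper(2)[of h] hyper(3)[of h] s[of h]] by simp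
  have "ln (?f h) = (A h * ln (B h) - ln (Gamma (A h)))
      - ((real (block_dim blk h) / 2 + A h + 1) * ln (s h) + 1/2 * (Q h b * (1 / s h)) + B h * (1 / s h))" for h
  proof -
    have "ln (?f h) = ln (s h powr (- real (block_dim blk h) / 2)) + ln (exp (- Q h b / (2 * s h)))
        + ln (ig_density (A h) (B h) (s h))"
      using s[of h] ig_density_pos[OF hyper(2)[of h] hyper(3)[of h] s[of h]] by (simp add: ln_mult)
    then show ?thesis
      using s[of h] by (simp add: ln_powr ln_ig_density[OF hyper(2)[of h] hyper(3)[of h] s[of h]] algebra_simps)
  qed
  then have "ln (\<Prod>h\<in>UNIV. ?f h) = (\<Sum>h\<in>UNIV. A h * ln (B h) - ln (Gamma (A h)))
      - (\<Sum>h\<in>UNIV. (real (block_dim blk h) / 2 + A h + 1) * ln (s h) + 1/2 * (Q h b * (1 / s h)) + B h * (1 / s h))"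
    by (subst ln_prod) (auto simp only: finite sum_subtractf less_imp_neq[OF pos, symmetric])
  moreover have "(\<Prod>h\<in>UNIV. ?f h) > 0"
    by (intro prod_pos) (simp only: pos)
  moreover have "ln (\<Prod>i\<in>UNIV. exp (- psi (y i) (C $ i \<bullet> b))) = - (\<Sum>i\<in>UNIV. psi (y i) (C $ i \<bullet> b))"
    by (simp add: ln_prod sum_negf)
  moreover have "(\<Prod>i\<in>UNIV. exp (- psi (y i) (C $ i \<bullet> b))) > 0"
    by (intro prod_pos) simp
  moreover have "ln (k * p * exp e * f) = ln k + ln p + e + ln f" if "k > 0" "p > 0" "f > 0" for k p e f :: real
    using that by (simp add: ln_mult)
  ultimately show ?thesis
    unfolding joint_eq using K by simp
qed

text \<open>The mean enters only through the smoothed losses and the quadratic forms. Traces with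
  \<open>S\<close> and inverse Gamma moments free of the mean go into \<open>c\<close>, whose value
  is irrelevant for derivatives.\<close>

lemma expected_log_joint_eq:
  obtains c where "\<And>m. expected_log_joint joint S al be m
    = c - (\<Sum>i\<in>UNIV. V i (C $ i \<bullet> m)) - (1/2) * (m \<bullet> (Rbar *v m))"
proof -
  define L where "L h = (LINT x|lborel. ig_density (al h) (be h) x * ln x)" for h
  have L: "has_bochner_integral lborel (\<lambda>x. ig_density (al h) (be h) x * ln x) (L h)" for h
    using ig_density_ln_integrable[OF ig(1)[of h] ig(2)[of h]] by (simp add: has_bochner_integral_iff L_def)
  define c0 where "c0 = ln K + (\<Sum>h\<in>UNIV. A h * ln (B h) - ln (Gamma (A h)))"
  define T where "T = (\<Sum>i\<in>UNIV. \<Sum>j\<in>UNIV. beta_mat Rb $ i $ j * S $ i $ j)"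
  have one: "has_bochner_integral lborel (\<lambda>b. mvn_density m S b * 1) 1" for m
    using mvn_integral[OF S] by simp
  have E: "has_q_expectation UNIV m S al be
     (\<lambda>(b, s). c0 - (\<Sum>i\<in>UNIV. psi (y i) (C $ i \<bullet> b)) - 1 / (2 * sb2) * Qb b
       - (\<Sum>h\<in>UNIV. (real (block_dim blk h) / 2 + A h + 1) * ln (s h) + 1/2 * (Q h b * (1 / s h)) + B h * (1 / s h)))
     (c0 * 1 - (\<Sum>i\<in>UNIV. V i (C $ i \<bullet> m)) - 1 / (2 * sb2) * (Qb m + T)
       - (\<Sum>h\<in>UNIV. (real (block_dim blk h) / 2 + A h + 1) * (1 * L h) + 1/2 * ((Q h m + Qtr h) * (al h / be h))
           + B h * (1 * (al h / be h))))" for m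
  proof -
    have const: "has_q_expectation UNIV m S al be (\<lambda>\<theta>. c0 * 1) (c0 * 1)"
      using q_gaussian[OF _ one, of UNIV]
      by (intro has_q_expectation_cmult) (simp add: case_prod_beta')
    have psi: "has_q_expectation UNIV m S al be (\<lambda>\<theta>. psi (y i) (C $ i \<bullet> fst \<theta>)) (V i (C $ i \<bullet> m))" for i
      using q_gaussian[OF _ psi_expectation[of m i], of UNIV]
      by (simp add: case_prod_beta')
    have Qb: "has_q_expectation UNIV m S al be (\<lambda>\<theta>. Qb (fst \<theta>)) (Qb m + T)"
      using q_gaussian[OF _ mvn_quadratic_form[OF S, of m "beta_mat Rb"], of UNIV]
      by (simp add: case_prod_beta' T_def)
    have ln: "has_q_expectation UNIV m S al be (\<lambda>\<theta>. 1 * ln (snd \<theta> h)) (1 * L h)" for h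
      using q_mixed[OF _ _ one L[of h], of UNIV]
      by (simp add: case_prod_beta')
    have Q: "has_q_expectation UNIV m S al be (\<lambda>\<theta>. Q h (fst \<theta>) * (1 / snd \<theta> h)) ((Q h m + Qtr h) * (al h / be h))" for h
      using q_mixed[OF _ _ Q_expectation ig_density_inverse_moment[OF ig(1)[of h] ig(2)[of h]], of UNIV]
      by (simp add: case_prod_beta')
    have inv: "has_q_expectation UNIV m S al be (\<lambda>\<theta>. 1 * (1 / snd \<theta> h)) (1 * (al h / be h))" for h
      using q_mixed[OF _ _ one ig_density_inverse_moment[OF ig(1)[of h] ig(2)[of h]], of UNIV]
      by (simp add: case_prod_beta')
    have "has_q_expectation UNIV m S al be
       (\<lambda>\<theta>. c0 * 1 - (\<Sum>i\<in>UNIV. psi (y i) (C $ i \<bullet> fst \<theta>)) - 1 / (2 * sb2) * Qb (fst \<theta>)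
         - (\<Sum>h\<in>UNIV. (real (block_dim blk h) / 2 + A h + 1) * (1 * ln (snd \<theta> h))
             + 1/2 * (Q h (fst \<theta>) * (1 / snd \<theta> h)) + B h * (1 * (1 / snd \<theta> h))))
       (c0 * 1 - (\<Sum>i\<in>UNIV. V i (C $ i \<bullet> m)) - 1 / (2 * sb2) * (Qb m + T)
         - (\<Sum>h\<in>UNIV. (real (block_dim blk h) / 2 + A h + 1) * (1 * L h) + 1/2 * ((Q h m + Qtr h) * (al h / be h))
             + B h * (1 * (al h / be h))))"
      by (intro has_q_expectation_diff has_q_expectation_add has_q_expectation_sum has_q_expectation_cmult
          const psi Qb ln Q inv)
    then show ?thesis
      by (simp add: case_prod_beta')
  qed
  define c where "c = c0 - T / (2 * sb2)
    - (\<Sum>h\<in>UNIV. (real (block_dim blk h) / 2 + A h + 1) * L h + 1/2 * (Qtr h * (al h / be h)) + B h * (al h / be h))"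
  show thesis
  proof (rule that[of c])
    fix m
    have "expected_log_joint joint S al be m
      = c0 * 1 - (\<Sum>i\<in>UNIV. V i (C $ i \<bullet> m)) - 1 / (2 * sb2) * (Qb m + T)
       - (\<Sum>h\<in>UNIV. (real (block_dim blk h) / 2 + A h + 1) * (1 * L h) + 1/2 * ((Q h m + Qtr h) * (al h / be h))
           + B h * (1 * (al h / be h)))"
      unfolding expected_log_joint_def
    proof (rule has_q_expectation_eq, subst has_q_expectation_cong[OF _ finite])
      show "ln (joint (b, s)) = (\<lambda>(b, s). c0 - (\<Sum>i\<in>UNIV. psi (y i) (C $ i \<bullet> b)) - 1 / (2 * sb2) * Qb b
       - (\<Sum>h\<in>UNIV. (real (block_dim blk h) / 2 + A h + 1) * ln (s h) + 1/2 * (Q h b * (1 / s h)) + B h * (1 / s h))) (b, s)"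
        if "\<And>h. h \<in> UNIV \<Longrightarrow> s h > 0" for b s
        using that by (simp only: ln_joint UNIV_I c0_def prod.case)
    qed (rule E)
    also have "\<dots> = c - (\<Sum>i\<in>UNIV. V i (C $ i \<bullet> m)) - (1/2) * (m \<bullet> (Rbar *v m))"
    proof -
      have "(\<Sum>h\<in>UNIV. a h * (1 * L h) + 1/2 * ((Q h m + Qtr h) * (al h / be h)) + B h * (1 * (al h / be h)))
        = (\<Sum>h\<in>UNIV. a h * L h + 1/2 * (Qtr h * (al h / be h)) + B h * (al h / be h))
          + 1/2 * (\<Sum>h\<in>UNIV. al h / be h * Q h m)" for a
        by (simp add: sum.distrib sum_distrib_left algebra_simps)
      then show ?thesis
        using hyper(1) by (simp only: prior_precision_quadratic[OF R(2)] c_def) (simp add: field_simps)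
    qed
    finally show "expected_log_joint joint S al be m
      = c - (\<Sum>i\<in>UNIV. V i (C $ i \<bullet> m)) - (1/2) * (m \<bullet> (Rbar *v m))" .
  qed
qed

text \<open>At a zero row \<open>variational_loss\<close> is whatever value \<open>deriv\<close>
  yields for an unsmoothed loss; it is multiplied by that row, so it cannot affect the gradient or
  the Hessian.\<close>

lemma has_grad_hess_expected_log_joint:
  assumes Psi1: "\<And>i. Psi1 $ i = variational_loss psi 1 (y i) (C $ i \<bullet> mu) (C $ i \<bullet> (S *v C $ i))"
    and Psi2: "\<And>i. Psi2 $ i = variational_loss psi 2 (y i) (C $ i \<bullet> mu) (C $ i \<bullet> (S *v C $ i))"
  shows "has_grad_hess (expected_log_joint joint S al be) mu
    (- (transpose C *v Psi1) - Rbar *v mu) (- (Rbar + transpose C ** diag_mat Psi2 ** C))"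
proof -
  obtain c where c: "\<And>m. expected_log_joint joint S al be m
    = c - (\<Sum>i\<in>UNIV. V i (C $ i \<bullet> m)) - (1/2) * (m \<bullet> (Rbar *v m))"
    using expected_log_joint_eq by blast
  \<comment> \<open>Guarding by \<open>C $ i \<noteq> 0\<close> lets a single choice produce the
    derivative functions for all rows.\<close>
  have "\<forall>i. \<exists>D. C $ i \<noteq> 0 \<longrightarrow>
    (\<forall>\<xi>. (V i has_real_derivative fst D \<xi>) (at \<xi>) \<and> (fst D has_real_derivative snd D \<xi>) (at \<xi>))"
  proof
    fix i
    show "\<exists>D. C $ i \<noteq> 0 \<longrightarrow>
      (\<forall>\<xi>. (V i has_real_derivative fst D \<xi>) (at \<xi>) \<and> (fst D has_real_derivative snd D \<xi>) (at \<xi>))"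
    proof (cases "C $ i = 0")
      case False
      obtain V1 V2 where "\<And>\<xi>. (V i has_real_derivative V1 \<xi>) (at \<xi>)"
          "\<And>\<xi>. (V1 has_real_derivative V2 \<xi>) (at \<xi>)"
        using gaussian_smoothing_twice_differentiable[OF nu_pos[OF False] psi_integrable[OF nu_pos[OF False]], of "y i"]
        by blast
      then show ?thesis
        by (intro exI[of _ "(V1, V2)"]) simp
    qed simp
  qed
  from choice[OF this] obtain D where D: "\<forall>i. C $ i \<noteq> 0 \<longrightarrow>
    (\<forall>\<xi>. (V i has_real_derivative fst (D i) \<xi>) (at \<xi>) \<and> (fst (D i) has_real_derivative snd (D i) \<xi>) (at \<xi>))"
    by blast
  define V1 V2 where "V1 i = fst (D i)" and "V2 i = snd (D i)" for i
  have V: "(V i has_real_derivative V1 i \<xi>) (at \<xi>)" "(V1 i has_real_derivative V2 i \<xi>) (at \<xi>)"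
    if "C $ i \<noteq> 0" for i \<xi>
    using D that by (simp_all only: V1_def V2_def) blast+
  \<comment> \<open>Equality as functions, not only at one point, is what allows the iterated
    \<open>deriv\<close> to be evaluated.\<close>
  have deriv1: "deriv (V i) = V1 i" and deriv2: "deriv (V1 i) = V2 i" if "C $ i \<noteq> 0" for i
    using V[OF that] by (auto intro!: ext DERIV_imp_deriv)
  show ?thesis
  proof (rule has_grad_hess_ridge_sum[OF c _ V])
    show "transpose Rbar = Rbar"
      using Rb R(1) by (intro transpose_prior_precision) (auto simp: sym_psd_def)
    show "Psi1 $ i = V1 i (C $ i \<bullet> mu)" if "C $ i \<noteq> 0" for i
      using deriv1[OF that] by (simp add: Psi1 variational_loss_def)
    show "Psi2 $ i = V2 i (C $ i \<bullet> mu)" if "C $ i \<noteq> 0" for i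
      using deriv1[OF that] deriv2[OF that] by (simp add: Psi2 variational_loss_def numeral_2_eq_2)
  qed
qed

section \<open>Full conditional and mean field update of one variance\<close>

lemma full_conditional_eq:
  assumes s: "\<And>k. k \<noteq> h \<Longrightarrow> s k > 0"
  shows "full_conditional joint h (b, s) x
    = ig_density (A h + real (block_dim blk h) / 2) (B h + Q h b / 2) x"
proof -
  let ?a = "A h + real (block_dim blk h) / 2" and ?b = "B h + Q h b / 2"
  have ab: "?a > 0" "?b > 0"
    using hyper(2,3)[of h] Q_nonneg[of b h] by (simp_all add: add_pos_nonneg)
  let ?f = "\<lambda>k t. t powr (- real (block_dim blk k) / 2) * exp (- Q k b / (2 * t)) * ig_density (A k) (B k) t"
  define \<kappa> where "\<kappa> = B h powr A h * Gamma ?a / (Gamma (A h) * ?b powr ?a)"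
  \<comment> \<open>\<open>D\<close> collects all that does not involve the variance of block
    \<open>h\<close>. It equals the integral of \<open>joint\<close> over that variance and, being
    positive for positive remaining variances, cancels in the quotient.\<close>
  define D where "D = K * (\<Prod>i\<in>UNIV. exp (- psi (y i) (C $ i \<bullet> b))) * exp (- Qb b / (2 * sb2))
      * (\<Prod>k\<in>UNIV - {h}. ?f k (s k)) * \<kappa>"
  have "D > 0"
  proof -
    have 1: "(\<Prod>i\<in>UNIV. exp (- psi (y i) (C $ i \<bullet> b))) > 0"
      by (intro prod_pos) simp
    have 2: "(\<Prod>k\<in>UNIV - {h}. ?f k (s k)) > 0"
    proof (intro prod_pos)
      fix k assume "k \<in> UNIV - {h}"
      then have "s k > 0" using s by simp
      then show "?f k (s k) > 0"
        using ig_density_pos[OF hyper(2)[of k] hyper(3)[of k]] by simp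
    qed
    have 3: "\<kappa> > 0"
      using ab hyper(2,3)[of h] by (simp add: \<kappa>_def Gamma_real_pos)
    show ?thesis
      unfolding D_def by (intro mult_pos_pos K 1 2 3 exp_gt_zero)
  qed
  have joint_upd: "joint (b, s(h := t)) = D * ig_density ?a ?b t" for t
  proof -
    have "?f h t = \<kappa> * ig_density ?a ?b t"
      using ig_density_conjugate[OF hyper(2)[of h] hyper(3)[of h], of "real (block_dim blk h) / 2" "Q h b / 2" t] Q_nonneg[of b h]
      by (simp add: \<kappa>_def)
    moreover have "(\<Prod>k\<in>UNIV. ?f k ((s(h := t)) k)) = ?f h t * (\<Prod>k\<in>UNIV - {h}. ?f k (s k))"
      by (subst prod.remove[of UNIV h]) (auto intro!: prod.cong)
    ultimately show ?thesis
      unfolding joint_eq D_def by (simp only: mult_ac)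
  qed
  have "(LINT t|lborel. joint (b, s(h := t))) = D"
    unfolding joint_upd using ig_density_integral[OF ab] by (simp add: has_bochner_integral_iff)
  then show ?thesis
    using \<open>D > 0\<close> by (simp add: full_conditional_def joint_upd)
qed

text \<open>The mean \<open>l\<close> of \<open>ln (B h + Q h b / 2)\<close> is never evaluated: it
  is free of \<open>x\<close> and ends in the proportionality constant, so only integrability has to
  be shown. Normalisation then fixes that constant, which gives uniqueness.\<close>

lemma mean_field_update_iff:
  "mean_field_update joint mu S al be h q \<longleftrightarrow>
     q = ig_density (A h + real (block_dim blk h) / 2) (B h + 1/2 * (Q h mu + Qtr h))"
proof -
  let ?a = "A h + real (block_dim blk h) / 2" and ?b = "B h + 1/2 * (Q h mu + Qtr h)"
  have a: "?a > 0"
    using hyper(2)[of h] by (simp add: add_pos_nonneg)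
  \<comment> \<open>An integral of a nonnegative function, so the new rate \<open>?b\<close> is
    positive without any computation with the trace.\<close>
  have "0 \<le> (LINT b|lborel. mvn_density mu S b * Q h b)"
    by (rule Bochner_Integration.integral_nonneg) (simp add: mvn_density_nonneg[OF S] Q_nonneg)
  also have "\<dots> = Q h mu + Qtr h"
    by (rule has_bochner_integral_integral_eq[OF Q_expectation])
  finally have "Q h mu + Qtr h \<ge> 0" .
  then have b: "?b > 0"
    using hyper(3)[of h] by (simp add: add_pos_nonneg)
  define l where "l = (LINT b|lborel. mvn_density mu S b * ln (B h + Q h b / 2))"
  have l: "has_bochner_integral lborel (\<lambda>b. mvn_density mu S b * ln (B h + Q h b / 2)) l"
  proof -
    have "integrable lborel (\<lambda>b. mvn_density mu S b * ln (B h + Q h b / 2))"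
    proof (rule Bochner_Integration.integrable_bound)
      show "integrable lborel (\<lambda>b. mvn_density mu S b * \<bar>ln (B h)\<bar> + mvn_density mu S b * Q h b * (1 / (2 * B h)))"
        using mvn_integral[OF S, of mu] Q_expectation[of mu h]
        by (intro Bochner_Integration.integrable_add integrable_mult_left) (auto simp: has_bochner_integral_iff)
      have [measurable]: "(\<lambda>b. Q h b) \<in> borel_measurable borel"
        by measurable
      show "(\<lambda>b. mvn_density mu S b * ln (B h + Q h b / 2)) \<in> borel_measurable lborel"
        by measurable
      show "AE b in lborel. norm (mvn_density mu S b * ln (B h + Q h b / 2))
          \<le> norm (mvn_density mu S b * \<bar>ln (B h)\<bar> + mvn_density mu S b * Q h b * (1 / (2 * B h)))"
      proof (rule AE_I2)
        fix b :: "real^('p + 'd)"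
        \<comment> \<open>From \<open>0 \<le> ln (1 + t) \<le> t\<close> with
          \<open>t = Q h b / (2 * B h)\<close>; the bound has a finite Gaussian mean because
          \<open>Q h b\<close> does.\<close>
        have "\<bar>ln (B h + Q h b / 2)\<bar> \<le> \<bar>ln (B h)\<bar> + Q h b / (2 * B h)"
        proof -
          have "B h + Q h b / 2 = B h * (1 + Q h b / (2 * B h))"
            using hyper(3)[of h] by (simp add: field_simps)
          moreover have pos: "1 + Q h b / (2 * B h) > 0"
            using hyper(3)[of h] Q_nonneg[of b h] by (intro add_pos_nonneg) auto
          have "ln (B h * (1 + Q h b / (2 * B h))) = ln (B h) + ln (1 + Q h b / (2 * B h))"
            by (rule ln_mult_pos[OF hyper(3) pos])
          ultimately have "ln (B h + Q h b / 2) = ln (B h) + ln (1 + Q h b / (2 * B h))"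
            by (simp only:)
          moreover have "ln (1 + Q h b / (2 * B h)) \<le> Q h b / (2 * B h)" "ln (1 + Q h b / (2 * B h)) \<ge> 0"
            using hyper(3)[of h] Q_nonneg[of b h] by (auto intro!: ln_add_one_self_le_self ln_ge_zero)
          ultimately show ?thesis by linarith
        qed
        then have "mvn_density mu S b * \<bar>ln (B h + Q h b / 2)\<bar>
            \<le> mvn_density mu S b * (\<bar>ln (B h)\<bar> + Q h b / (2 * B h))"
          by (intro mult_left_mono mvn_density_nonneg S)
        also have "\<dots> \<le> \<bar>mvn_density mu S b * (\<bar>ln (B h)\<bar> + Q h b / (2 * B h))\<bar>"
          by (rule abs_ge_self)
        finally show "norm (mvn_density mu S b * ln (B h + Q h b / 2))
          \<le> norm (mvn_density mu S b * \<bar>ln (B h)\<bar> + mvn_density mu S b * Q h b * (1 / (2 * B h)))"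
          using mvn_density_nonneg[OF S, of mu b] by (simp add: abs_mult distrib_left)
      qed
    qed
    then show ?thesis
      by (simp add: l_def has_bochner_integral_iff)
  qed
  \<comment> \<open>\<open>Gamma ?a / ?b powr ?a\<close> undoes the normalisation of the updated
    density; the exponential is the part of the averaged logarithm that is free of
    \<open>x\<close>.\<close>
  define c where "c = exp (?a * l - ln (Gamma ?a)) * Gamma ?a / ?b powr ?a"
  have "c > 0"
    using a b by (simp add: c_def Gamma_real_pos)
  have E: "exp (q_expectation (UNIV - {h}) mu S al be (\<lambda>\<theta>. ln (full_conditional joint h \<theta> x)))
      = c * ig_density ?a ?b x" if x: "x > 0" for x
  proof -
    have "has_bochner_integral lborel (\<lambda>b. ?a * (mvn_density mu S b * ln (B h + Q h b / 2))
        - (ln (Gamma ?a) + (?a + 1) * ln x + B h / x) * mvn_density mu S b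
        - 1 / (2 * x) * (mvn_density mu S b * Q h b))
      (?a * l - (ln (Gamma ?a) + (?a + 1) * ln x + B h / x) * 1 - 1 / (2 * x) * (Q h mu + Qtr h))"
      by (intro has_bochner_integral_diff has_bochner_integral_mult_right l mvn_integral S Q_expectation)
    moreover have "?a * (mvn_density mu S b * ln (B h + Q h b / 2))
        - (ln (Gamma ?a) + (?a + 1) * ln x + B h / x) * mvn_density mu S b
        - 1 / (2 * x) * (mvn_density mu S b * Q h b)
        = mvn_density mu S b * ln (ig_density ?a (B h + Q h b / 2) x)" for b
    proof -
      have "B h + Q h b / 2 > 0"
        using hyper(3)[of h] Q_nonneg[of b h] by (simp add: add_pos_nonneg)
      then show ?thesis
        using x by (simp only: ln_ig_density[OF a]) (simp add: field_simps)
    qed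
    ultimately have "has_bochner_integral lborel (\<lambda>b. mvn_density mu S b * ln (ig_density ?a (B h + Q h b / 2) x))
      (?a * l - (ln (Gamma ?a) + (?a + 1) * ln x + B h / x) * 1 - 1 / (2 * x) * (Q h mu + Qtr h))"
      by (simp only:)
    \<comment> \<open>For positive variances the full conditional involves none of the other
      variances, so the expectation is a Gaussian integral.\<close>
    from q_gaussian[OF _ this, of "UNIV - {h}"]
    have "has_q_expectation (UNIV - {h}) mu S al be (\<lambda>\<theta>. ln (full_conditional joint h \<theta> x))
      (?a * l - (ln (Gamma ?a) + (?a + 1) * ln x + B h / x) * 1 - 1 / (2 * x) * (Q h mu + Qtr h))"
      by (subst has_q_expectation_cong[where F' = "\<lambda>(b, s). ln (ig_density ?a (B h + Q h b / 2) x)"])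
         (auto simp: full_conditional_eq)
    then have "q_expectation (UNIV - {h}) mu S al be (\<lambda>\<theta>. ln (full_conditional joint h \<theta> x))
      = (?a * l - ln (Gamma ?a)) + ((- ?a - 1) * ln x) + (- ?b / x)"
      using x by (simp only: has_q_expectation_eq) (simp add: field_simps)
    then have "exp (q_expectation (UNIV - {h}) mu S al be (\<lambda>\<theta>. ln (full_conditional joint h \<theta> x)))
      = exp (?a * l - ln (Gamma ?a)) * x powr (- ?a - 1) * exp (- ?b / x)"
      using x by (simp only: exp_add) (simp add: powr_def)
    also have "\<dots> = c * ig_density ?a ?b x"
      unfolding c_def ig_density_def using x b Gamma_real_nonzero[OF a] by simp
    finally show ?thesis .
  qed
  show ?thesis
  proof
    assume "mean_field_update joint mu S al be h q"
    then obtain k where k: "\<And>x. x \<le> 0 \<Longrightarrow> q x = 0" "has_bochner_integral lborel q 1"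
      "\<And>x. x > 0 \<Longrightarrow> q x = k * (c * ig_density ?a ?b x)"
      unfolding mean_field_update_def using E by auto
    have q: "q x = k * c * ig_density ?a ?b x" for x
      using k(1,3)[of x] ig_density_nonpos[of x ?a ?b] by (cases "x > 0") auto
    \<comment> \<open>\<open>q\<close> and the inverse Gamma density both have total mass 1, which
      forces \<open>k * c = 1\<close>.\<close>
    have "has_bochner_integral lborel (\<lambda>x. k * c * ig_density ?a ?b x) (k * c * 1)"
      by (intro has_bochner_integral_mult_right ig_density_integral a b)
    moreover have "(\<lambda>x. k * c * ig_density ?a ?b x) = q"
      by (simp add: q fun_eq_iff)
    ultimately have "k * c = 1"
      using k(2) has_bochner_integral_eq by fastforce
    then show "q = ig_density ?a ?b"
      by (simp add: q fun_eq_iff)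
  next
    assume q: "q = ig_density ?a ?b"
    show "mean_field_update joint mu S al be h q"
      unfolding mean_field_update_def
    proof (intro conjI exI[of _ "1 / c"] allI impI)
      show "q x = 1 / c * exp (q_expectation (UNIV - {h}) mu S al be (\<lambda>\<theta>. ln (full_conditional joint h \<theta> x)))"
        if "x > 0" for x
        using \<open>c > 0\<close> by (simp only: E[OF that] q) simp
      show "has_bochner_integral lborel q 1"
        unfolding q by (rule ig_density_integral[OF a b])
    qed (use \<open>c > 0\<close> q in \<open>auto simp: ig_density_nonpos\<close>)
  qed
qed

end

theorem proposition2:
  fixes psi :: "'y::topological_space \<Rightarrow> real \<Rightarrow> real"
    and y :: "'n::finite \<Rightarrow> 'y"
    and blk :: "'d::finite \<Rightarrow> 'h::finite"
    and X :: "real^'p::finite^'n" and Z :: "real^'d^'n" and C :: "real^('p + 'd)^'n"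
    and sb2 :: real and Rb :: "real^'p^'p" and R :: "'h \<Rightarrow> real^'d^'d"
    and A B :: "'h \<Rightarrow> real"
    and joint :: "(real^('p + 'd)) \<times> ('h \<Rightarrow> real) \<Rightarrow> real"
    and mu :: "real^('p + 'd)" and S :: "real^('p + 'd)^('p + 'd)"
    and al be :: "'h \<Rightarrow> real"
    and xi nu2 p :: "real^'n" and Psi :: "nat \<Rightarrow> real^'n"
    and W :: "real^'n^'n" and Rbar :: "real^('p + 'd)^('p + 'd)"
  assumes psi_continuous: "continuous_on UNIV (\<lambda>(v, e). psi v e)"
    and psi_integrable:
      "\<And>v m \<tau>. \<tau> > 0 \<Longrightarrow> integrable lborel (\<lambda>e. normal_density m \<tau> e * psi v e)"
    and Rb: "sym_psd Rb"
    and R: "\<And>h. sym_psd (R h)" "\<And>h. block_mat blk h (R h) = R h"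
    and hyper: "sb2 > 0" "\<And>h. A h > 0" "\<And>h. B h > 0"
    and joint: "\<exists>K>0. \<forall>\<theta>. joint \<theta> = K * joint_kernel psi y blk X Z sb2 Rb R A B \<theta>"
    and current: "sym_pd S" "\<And>h. al h > 0" "\<And>h. be h > 0"
    and C_def: "C = design_mat X Z"
    and xi_def: "xi = (\<chi> i. C $ i \<bullet> mu)"
    and nu2_def: "nu2 = (\<chi> i. C $ i \<bullet> (S *v C $ i))"
    and Psi_def: "\<And>r. Psi r = (\<chi> i. variational_loss psi r (y i) (xi $ i) (nu2 $ i))"
    and p_def: "p = (\<chi> i. - (Psi 1 $ i / Psi 2 $ i) + xi $ i)"
    and W_def: "W = diag_mat (Psi 2)"
    and Rbar_def: "Rbar = prior_precision blk sb2 Rb R al be"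
    and Psi2_nonzero: "\<And>i. Psi 2 $ i \<noteq> 0"
    and precision_invertible: "invertible (Rbar + transpose C ** W ** C)"
  defines "lambda1 \<equiv> transpose C *v (W *v p)"
    and "lambda2 \<equiv> - ((1/2) *\<^sub>R (Rbar + transpose C ** W ** C))"
    and "S' \<equiv> matrix_inv (Rbar + transpose C ** W ** C)"
    and "mu' \<equiv> matrix_inv (Rbar + transpose C ** W ** C) *v (transpose C *v (W *v p))"
  shows "(\<forall>l1 l2. ncvmp_natural joint mu S al be l1 l2 \<longleftrightarrow> l1 = lambda1 \<and> l2 = lambda2)
    \<and> (\<forall>m V. ncvmp_mean_var joint mu S al be m V \<longleftrightarrow> V = S' \<and> m = mu')
    \<and> natural_params mu' S' = (lambda1, lambda2)
    \<and> (\<forall>h q. mean_field_update joint mu S al be h q \<longleftrightarrow>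
         q = ig_density (A h + real (block_dim blk h) / 2)
               (B h + 1/2 * (block_vec blk h (u_part mu) \<bullet> (R h *v block_vec blk h (u_part mu))
                             + trace (R h ** block_mat blk h (uu_part S)))))"
proof -
  obtain K where K: "K > 0" "\<And>\<theta>. joint \<theta> = K * joint_kernel psi y blk X Z sb2 Rb R A B \<theta>"
    using joint by blast
  have "psi v \<in> borel_measurable borel" for v
  proof (rule borel_measurable_continuous_onI)
    have "continuous_on UNIV (\<lambda>e. (v, e))"
      by (intro continuous_intros)
    from continuous_on_compose2[OF psi_continuous this] show "continuous_on UNIV (psi v)"
      by simp
  qed
  then interpret glmm psi y blk X Z C sb2 Rb R A B joint K S al be
    using psi_integrable Rb R hyper K current C_def by unfold_locales auto
  \<comment> \<open>Minus the Hessian; in terms of \<open>P\<close> the two parametrisations differ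
    by linear algebra only.\<close>
  define P where "P = Rbar + transpose C ** W ** C"
  define g where "g = - (transpose C *v Psi 1) - Rbar *v mu"
  have P: "invertible P"
    using precision_invertible by (simp only: P_def)
  have gh: "has_grad_hess (expected_log_joint joint S al be) mu g (- P)"
    unfolding g_def P_def W_def Rbar_def
    by (rule has_grad_hess_expected_log_joint) (simp_all add: Psi_def xi_def nu2_def)
  then have gh_iff: "has_grad_hess (expected_log_joint joint S al be) mu g' H' \<longleftrightarrow> g' = g \<and> H' = - P" for g' H'
    using has_grad_hess_unique by blast
  have "C *v mu = xi"
    by (simp add: xi_def vec_eq_iff matrix_vector_mul_component)
  \<comment> \<open>The weights undo the element-wise division in \<open>p\<close>, which is where
    nonzero entries of \<open>Psi 2\<close> enter. In \<open>g + P *v mu\<close> the prior terms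
    cancel, and what is left is \<open>transpose C\<close> applied to this vector.\<close>
  moreover have "W *v p = W *v xi - Psi 1"
    using Psi2_nonzero by (simp add: W_def p_def diag_mat_mult vec_eq_iff field_simps)
  ultimately have lambda1: "g + P *v mu = lambda1"
    by (simp add: g_def P_def lambda1_def matrix_vector_mult_add_rdistrib matrix_vector_mult_diff_distrib
        flip: matrix_vector_mul_assoc)
  have neg_mult: "(- M) *v v = - (M *v v)" for M :: "real^('p + 'd)^('p + 'd)" and v
    by (simp add: vec_eq_iff matrix_vector_mult_def sum_negf)
  have neg_inverse: "(- P) ** (- matrix_inv P) = mat 1"
    using matrix_inv_mult(1)[OF P] by (simp add: matrix_matrix_mult_def vec_eq_iff)
  then have inv_neg: "matrix_inv (- P) = - matrix_inv P"
    by (rule matrix_inv_unique)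
  have P_inv: "matrix_inv P *v (P *v v) = v" "P *v (matrix_inv P *v v) = v" for v
    by (simp_all add: matrix_vector_mul_assoc matrix_inv_mult[OF P])
  \<comment> \<open>The left side is the Newton step for the Hessian \<open>- P\<close>; taking out
    \<open>matrix_inv P\<close> exposes the natural parameter \<open>lambda1\<close>.\<close>
  have "mu + matrix_inv P *v g = matrix_inv P *v (g + P *v mu)"
    by (simp add: matrix_vector_right_distrib P_inv)
  then have mu': "mu + matrix_inv P *v g = mu'"
    unfolding lambda1 by (simp only: mu'_def lambda1_def P_def)
  have "ncvmp_natural joint mu S al be l1 l2 \<longleftrightarrow> l1 = lambda1 \<and> l2 = lambda2" for l1 l2
  proof -
    have "g - (- P) *v mu = lambda1"
      by (simp add: neg_mult lambda1)
    moreover have "(1/2) *\<^sub>R (- P) = lambda2"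
      by (simp only: lambda2_def P_def scaleR_minus_right)
    ultimately show ?thesis
      unfolding ncvmp_natural_def gh_iff by auto
  qed
  moreover have "ncvmp_mean_var joint mu S al be m U \<longleftrightarrow> U = S' \<and> m = mu'" for m U
  proof -
    have "invertible (- P)"
      using neg_inverse by (auto simp: invertible_right_inverse)
    then show ?thesis
      unfolding ncvmp_mean_var_def gh_iff
      by (auto simp: inv_neg neg_mult mu' S'_def P_def[symmetric])
  qed
  moreover have "natural_params mu' S' = (lambda1, lambda2)"
  proof -
    have "matrix_inv S' = P"
      unfolding S'_def P_def[symmetric] by (rule matrix_inv_unique) (rule matrix_inv_mult(2)[OF P])
    moreover have "P *v mu' = lambda1"
      by (simp only: mu'_def lambda1_def P_def[symmetric] P_inv)
    ultimately show ?thesis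
      by (simp add: natural_params_def lambda2_def P_def)
  qed
  moreover have "mean_field_update joint mu S al be h q \<longleftrightarrow>
      q = ig_density (A h + real (block_dim blk h) / 2)
            (B h + 1/2 * (block_vec blk h (u_part mu) \<bullet> (R h *v block_vec blk h (u_part mu))
                          + trace (R h ** block_mat blk h (uu_part S))))" for h q
    unfolding Q_eq by (rule mean_field_update_iff)
  ultimately show ?thesis
    by blast
qed

end
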